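(* Let $S_1\in\mathbb{R}^{p_1\times n}$ and $S_2\in\mathbb{R}^{p_2\times p_1}$ be independently generated $(\varepsilon_1,d_1,m)$ and $(\varepsilon_2,d_2,m)$ oblivious $\ell_2$-subspace embeddings, respectively. Put $d=d_1+d_2-d_1d_2$, $\varepsilon_L=\varepsilon_1+\varepsilon_2-\varepsilon_1\varepsilon_2$, $\varepsilon_H=\varepsilon_1+\varepsilon_2+\varepsilon_1\varepsilon_2$, and suppose $\varepsilon_L\in\left[0,\frac{616}{625}-\frac{9}{625}\varepsilon_H\right)$. Suppose $V\in\mathbb{R}^{n\times m}$ has full rank, $1<m\le p_2\le p_1\le n$, $nm\mathbf{u}\le\frac1{12}$, $p_1\sqrt{p_2}\,\mathbf{u}\le\frac1{12}$, and $$\delta:=\frac{383\left(\sqrt{1+\varepsilon_H}\,p_2m^{3/2}+\sqrt m\,\|S_2\|_2\left(p_1\sqrt{p_2}\sqrt{1+\varepsilon_1}+n\|S_1\|_F\right)\right)}{\sqrt{1-\varepsilon_L}}\,\mathbf{u}\,\kappa(V)\le 1 .$$ Let $\hat Q$ be the orthogonal factor computed in floating point arithmetic by $\texttt{rand\_cholQR}(V,S_1,S_2)$. Then, with probability at least $1-d$, $\kappa(\hat Q)\approx1$; more specifically, $$\kappa(\hat Q)<\sqrt{\frac{1+\frac{5445}{\left(25\sqrt{\frac{1-\varepsilon_L}{1+\varepsilon_H}}-3\right)^2}(nm+m(m+1))\mathbf{u}}{1-\frac{5445}{\left(25\sqrt{\frac{1-\varepsilon_L}{1+\varepsilon_H}}-3\right)^2}(nm+m(m+1))\mathbf{u}}}\;.$$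 Furthermore, if $\frac{5445}{\left(25\sqrt{\frac{1-\varepsilon_L}{1+\varepsilon_H}}-3\right)^2}(nm+m(m+1))\mathbf{u}<\frac12$, then (with the same probability) $$\kappa(\hat Q)<1+\frac{10890}{\left(25\sqrt{\frac{1-\varepsilon_L}{1+\varepsilon_H}}-3\right)^2}(nm+m(m+1))\mathbf{u}.$$
   Context: Embeddings. For $\varepsilon\in[0,1)$, a matrix $S\in\mathbb{R}^{p\times n}$ is an $\varepsilon$-subspace embedding for a subspace $\mathcal V\subset\mathbb{R}^n$ if $|\langle x,y\rangle-\langle Sx,Sy\rangle|\le\varepsilon\|x\|_2\|y\|_2$ for all $x,y\in\mathcal V$. A random $S\in\mathbb{R}^{p\times n}$ is an $(\varepsilon,d,m)$ oblivious $\ell_2$-subspace embedding if, for any fixed $m$-dimensional subspace $\mathcal V\subset\mathbb{R}^n$, it is an $\varepsilon$-subspace embedding for $\mathcal V$ with probability at least $1-d$. Probabilities are over the draw of the sketch matrices; $V$ is fixed. The norms of $S_1,S_2$ appearing in $\delta$ are those of the drawn matrices, for which $\delta\le1$ is assumed. Notation. $\sigma_1\ge\dots\ge\sigma_m$ are singular values, $\kappa(X)=\sigma_1(X)/\sigma_m(X)$ for $X$ with $m$ columns, $\mathbf{u}$ is the unit roundoff, $\gamma_k=\frac{k\mathbf{u}}{1-k\mathbf{u}}$, $|A|$ is the entrywise absolute value (inequalities between such matrices are entrywise), hats denote computed quantities. Algorithm $\texttt{randQR}(V,S_1,S_2)$: (1) compute $W_1=S_1V$ and then $W=S_2W_1$;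 (2) compute a Householder QR factorization of $W$, keeping its $m\times m$ upper triangular factor $R$; (3) compute $Q=VR^{-1}$ by solving the triangular system $QR=V$ row by row. Output $Q,R$. Algorithm $\texttt{cholQR}(X)$: (1) compute $G=X^TX$; (2) compute the Cholesky factor $R$, $G=R^TR$; (3) compute $Q=XR^{-1}$ by solving $QR=X$ row by row. Output $Q,R$. Algorithm $\texttt{rand\_cholQR}(V,S_1,S_2)$: (1) $[Q_0,R_0]=\texttt{randQR}(V,S_1,S_2)$; (2) $[Q,R_1]=\texttt{cholQR}(Q_0)$; (3) $R=R_1R_0$. Output $Q,R$. Floating point. All steps are executed in the standard model of floating point arithmetic with unit roundoff $\mathbf{u}$ (each elementary operation has relative error at most $\mathbf{u}$, no overflow or underflow). The standard rounding error bounds for the subroutines are: a computed product of matrices $A,B$ with inner dimension $k$ is $AB+\Delta C$ with $|\Delta C|\le\gamma_k|A||B|$; Householder QR of $\hat W\in\mathbb{R}^{p_2\times m}$ returns upper triangular $\hat R$ for which there is a $Q_{tmp}\in\mathbb{R}^{p_2\times m}$ with exactly orthonormal columns and $\hat W+E_2=Q_{tmp}\hat R$, where $\|(E_2)_j\|_2\le\gamma_{29p_2m}\|\hat w_j\|_2$ for each column $j$; the row-wise solution of $Q\hat R=V$ returns $\hat Q$ with $\hat Q_{i,:}(\hat R+\Delta R_i)=V_{i,:}$, $|\Delta R_i|\le\gamma_m|\hat R|$, for each row $i$; the Cholesky factorization of a computed $\hat G\in\mathbb{R}^{m\times m}$ returns $\hat R$ with $\hat R^T\hat R=\hat G+E$,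 $|E|\le\gamma_{m+1}|\hat R|^T|\hat R|$.
   Formalization: The first bound is stated only when 5445/(...)^2 (nm+m(m+1))u < 1; the hypotheses do not imply this, and otherwise its right-hand side is undefined. Also d1, d2 are taken in [0,1] and u > 0, without which the claim can fail. *)

theory Defs
  imports "HOL-Probability.Probability"
begin

text \<open>
  A matrix with \<open>p\<close> rows and \<open>n\<close> columns is an element of
  \<^typ>\<open>real^'n^'p\<close>, where the cardinalities of the index types are the dimensions.  On
  matrices, the library's \<open>\<bar>A\<bar>\<close> and \<open>A \<le> B\<close> are the
  entrywise absolute value and order, and \<^term>\<open>norm\<close> is the Frobenius norm.  The
  spectral norm is \<^const>\<open>onorm\<close>.
\<close>

section \<open>Singular values and condition number\<close>

text \<open>
  For a matrix with at least as many rows as columns these are all the singular values, including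
  0 in the case of a rank deficient matrix.  Multiplicities play no role for the largest and the
  smallest one.
\<close>

definition singular_values :: "real^'m^'n \<Rightarrow> real set" where
  "singular_values X =
     {s. 0 \<le> s \<and> (\<exists>v. v \<noteq> 0 \<and> (transpose X ** X) *v v = s\<^sup>2 *\<^sub>R v)}"

definition sigma_max :: "real^'m^'n \<Rightarrow> real" where
  "sigma_max X = Max (singular_values X)"

definition sigma_min :: "real^'m^'n \<Rightarrow> real" where
  "sigma_min X = Min (singular_values X)"

text \<open>
  The condition number is infinite for rank deficient matrices; with the convention
  \<open>x / 0 = 0\<close> of \<^typ>\<open>real\<close> every upper bound on it would hold for them.
\<close>

definition kappa :: "real^'m^'n \<Rightarrow> ereal" where
  "kappa X = (if sigma_min X = 0 then \<infinity> else ereal (sigma_max X / sigma_min X))"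

section \<open>Subspace embeddings\<close>

definition subspace_embedding :: "real \<Rightarrow> (real^'n) set \<Rightarrow> real^'n^'p \<Rightarrow> bool" where
  "subspace_embedding \<epsilon> \<V> S \<longleftrightarrow>
     (\<forall>x\<in>\<V>. \<forall>y\<in>\<V>. \<bar>x \<bullet> y - (S *v x) \<bullet> (S *v y)\<bar> \<le> \<epsilon> * norm x * norm y)"

definition oblivious_embedding ::
  "'a measure \<Rightarrow> real \<Rightarrow> real \<Rightarrow> nat \<Rightarrow> ('a \<Rightarrow> real^'n^'p) \<Rightarrow> bool" where
  "oblivious_embedding M \<epsilon> d m S \<longleftrightarrow>
     S \<in> borel_measurable M \<and>
     (\<forall>\<V>. subspace \<V> \<and> dim \<V> = m \<longrightarrow>
        measure M {\<omega>\<in>space M. subspace_embedding \<epsilon> \<V> (S \<omega>)} \<ge> 1 - d)"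

text \<open>
  The library's \<open>indep_var\<close> requires the two random variables to have the same type;
  here the types of the values differ.
\<close>

definition independent_matrices ::
  "'a measure \<Rightarrow> ('a \<Rightarrow> real^'n^'p) \<Rightarrow> ('a \<Rightarrow> real^'k^'q) \<Rightarrow> bool" where
  "independent_matrices M X Y \<longleftrightarrow>
     prob_space.indep_set M {X -` A \<inter> space M |A. A \<in> sets borel}
                            {Y -` B \<inter> space M |B. B \<in> sets borel}"

section \<open>Floating point computations\<close>

text \<open>
  A subroutine is modelled by the relation between its input and those outputs that satisfy its
  standard rounding error bound for the unit roundoff \<open>u\<close>.
\<close>

definition gam :: "real \<Rightarrow> nat \<Rightarrow> real" where
  "gam u k = real k * u / (1 - real k * u)"

text \<open>
  The same type as \<open>real^'n^'p\<close>, with rows first; the \<open>^\<close> notation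
  attaches a sort to each type variable and so excludes index types with an order.
\<close>

type_synonym ('p, 'n) rmat = "((real, 'n) vec, 'p) vec"

definition upper_triangular :: "('m::{finite,linorder}, 'm) rmat \<Rightarrow> bool" where
  "upper_triangular R \<longleftrightarrow> (\<forall>i j. j < i \<longrightarrow> R $ i $ j = 0)"

definition fl_matmul :: "real \<Rightarrow> real^'k^'p \<Rightarrow> real^'n^'k \<Rightarrow> real^'n^'p \<Rightarrow> bool" where
  "fl_matmul u A B C \<longleftrightarrow>
     (\<exists>\<Delta>C. C = A ** B + \<Delta>C \<and> \<bar>\<Delta>C\<bar> \<le> gam u CARD('k) *\<^sub>R (\<bar>A\<bar> ** \<bar>B\<bar>))"

definition fl_householder ::
  "real \<Rightarrow> ('p::finite, 'm::{finite,linorder}) rmat \<Rightarrow> ('m, 'm) rmat \<Rightarrow> bool" where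
  "fl_householder u W R \<longleftrightarrow>
     upper_triangular R \<and>
     (\<exists>(Qtmp :: ('p, 'm) rmat) E.
        transpose Qtmp ** Qtmp = mat 1 \<and> W + E = Qtmp ** R \<and>
        (\<forall>j. norm (column j E) \<le> gam u (29 * CARD('p) * CARD('m)) * norm (column j W)))"

text \<open>Row-wise solution of \<open>Q R = V\<close>: every row has its own backward error.\<close>

definition fl_trisolve :: "real \<Rightarrow> real^'m^'n \<Rightarrow> real^'m^'m \<Rightarrow> real^'m^'n \<Rightarrow> bool" where
  "fl_trisolve u V R Q \<longleftrightarrow>
     (\<forall>i. \<exists>\<Delta>R. (Q $ i) v* (R + \<Delta>R) = V $ i \<and> \<bar>\<Delta>R\<bar> \<le> gam u CARD('m) *\<^sub>R \<bar>R\<bar>)"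

definition fl_cholesky ::
  "real \<Rightarrow> ('m::{finite,linorder}, 'm) rmat \<Rightarrow> ('m, 'm) rmat \<Rightarrow> bool" where
  "fl_cholesky u G R \<longleftrightarrow>
     upper_triangular R \<and>
     (\<exists>E. transpose R ** R = G + E \<and>
          \<bar>E\<bar> \<le> gam u (CARD('m) + 1) *\<^sub>R (transpose \<bar>R\<bar> ** \<bar>R\<bar>))"

definition fl_randQR ::
  "real \<Rightarrow> ('n::finite, 'm::{finite,linorder}) rmat \<Rightarrow> ('p1::finite, 'n) rmat \<Rightarrow>
   ('p2::finite, 'p1) rmat \<Rightarrow> ('n, 'm) rmat \<Rightarrow> ('m, 'm) rmat \<Rightarrow> bool" where
  "fl_randQR u V S1 S2 Q R \<longleftrightarrow>
     (\<exists>W1 W. fl_matmul u S1 V W1 \<and> fl_matmul u S2 W1 W \<and>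
             fl_householder u W R \<and> fl_trisolve u V R Q)"

definition fl_cholQR ::
  "real \<Rightarrow> ('n::finite, 'm::{finite,linorder}) rmat \<Rightarrow> ('n, 'm) rmat \<Rightarrow> ('m, 'm) rmat \<Rightarrow> bool" where
  "fl_cholQR u X Q R \<longleftrightarrow>
     (\<exists>G. fl_matmul u (transpose X) X G \<and> fl_cholesky u G R \<and> fl_trisolve u X R Q)"

definition fl_rand_cholQR ::
  "real \<Rightarrow> ('n::finite, 'm::{finite,linorder}) rmat \<Rightarrow> ('p1::finite, 'n) rmat \<Rightarrow>
   ('p2::finite, 'p1) rmat \<Rightarrow> ('n, 'm) rmat \<Rightarrow> ('m, 'm) rmat \<Rightarrow> bool" where
  "fl_rand_cholQR u V S1 S2 Q R \<longleftrightarrow>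
     (\<exists>Q0 R0 R1. fl_randQR u V S1 S2 Q0 R0 \<and> fl_cholQR u Q0 Q R1 \<and> fl_matmul u R1 R0 R)"

end

theory Submission
  imports Defs
begin

text \<open>
  On the event that \<open>S1\<close> embeds the range of \<open>V\<close> and \<open>S2\<close> embeds its image (Fubini: for every good
  \<open>S1\<close> the image is a fixed subspace of dimension \<open>m\<close>), \<open>S2 S1\<close> distorts norms on the range of \<open>V\<close>
  by factors between \<open>a = sqrt (1 - \<epsilon>L)\<close> and \<open>b = sqrt (1 + \<epsilon>H)\<close>.  The bound on \<open>\<delta>\<close> makes the
  rounding errors of sketching and of Householder QR at most a tenth of \<open>a\<close> times the smallest
  singular value of \<open>V\<close>, so the first triangular factor has the norms of \<open>V\<close> up to
  constants and \<open>Q0\<close> has condition number at most \<open>33 / (25 a / b - 3)\<close>.  For a matrix of condition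
  number \<open>K\<close>, one pass of Cholesky QR loses orthogonality by less than \<open>5 K\<^sup>2 (nm + m(m+1)) u\<close>,
  and \<open>5 * 33\<^sup>2 = 5445\<close>.
\<close>

section \<open>Frobenius norms and backward errors\<close>

lemma norm_matrix_sq_rows: "(norm A)\<^sup>2 = (\<Sum>i\<in>UNIV. (norm (A $ i))\<^sup>2)" for A :: "real^'m^'n"
  by (simp add: norm_vec_def L2_set_def sum_nonneg)

lemma norm_transpose [simp]: "norm (transpose A) = norm A" for A :: "real^'m^'n"
proof -
  have "(norm (transpose A))\<^sup>2 = (norm A)\<^sup>2"
    unfolding norm_matrix_sq_rows by (simp add: norm_vec_def L2_set_def sum_nonneg transpose_def) (rule sum.swap)
  then show ?thesis by simp
qed

lemma norm_matrix_sq_columns: "(norm A)\<^sup>2 = (\<Sum>j\<in>UNIV. (norm (column j A))\<^sup>2)" for A :: "real^'m^'n"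
proof -
  have "transpose A $ j = column j A" for j
    by (simp add: transpose_def column_def)
  then show ?thesis
    using norm_matrix_sq_rows[of "transpose A"] by simp
qed

lemma norm_abs_matrix [simp]: "norm \<bar>A\<bar> = norm A" for A :: "real^'m^'n"
  by (simp add: norm_vec_def L2_set_def abs_vec_def)

text \<open>Error matrices are measured in the Frobenius norm because it is monotone under entrywise
  domination and unchanged by entrywise absolute values; entrywise rounding bounds carry over
  without dimension factors.\<close>

lemma norm_matrix_mono_abs:
  fixes A B :: "real^'m^'n"
  assumes "\<bar>A\<bar> \<le> B"
  shows "norm A \<le> norm B"
proof -
  have "\<bar>A $ i $ j\<bar> \<le> B $ i $ j" for i j
    using assms by (simp add: less_eq_vec_def abs_vec_def)
  then have "\<bar>A $ i $ j\<bar> \<le> \<bar>B $ i $ j\<bar>" for i j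
    by (metis abs_ge_self order_trans)
  then show ?thesis
    by (metis norm_le_componentwise_cart real_norm_def)
qed

lemma norm_matrix_vector_le: "norm (A *v x) \<le> norm A * norm x" for A :: "real^'m^'n"
proof (rule power2_le_imp_le)
  have "(norm (A *v x))\<^sup>2 = (\<Sum>i\<in>UNIV. ((A $ i) \<bullet> x)\<^sup>2)"
    by (simp add: norm_vec_def L2_set_def sum_nonneg matrix_vector_mult_def inner_vec_def)
  also have "\<dots> \<le> (\<Sum>i\<in>UNIV. (norm (A $ i))\<^sup>2 * (norm x)\<^sup>2)"
  proof (rule sum_mono)
    fix i
    have "\<bar>(A $ i) \<bullet> x\<bar> \<le> norm (A $ i) * norm x" by (rule Cauchy_Schwarz_ineq2)
    then have "\<bar>(A $ i) \<bullet> x\<bar>\<^sup>2 \<le> (norm (A $ i) * norm x)\<^sup>2" by (rule power_mono) simp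
    then show "((A $ i) \<bullet> x)\<^sup>2 \<le> (norm (A $ i))\<^sup>2 * (norm x)\<^sup>2"
      by (simp add: power_mult_distrib)
  qed
  also have "\<dots> = (norm A * norm x)\<^sup>2"
    by (simp add: norm_matrix_sq_rows power_mult_distrib sum_distrib_right)
  finally show "(norm (A *v x))\<^sup>2 \<le> (norm A * norm x)\<^sup>2" .
qed simp

lemma norm_vector_matrix_le: "norm (x v* A) \<le> norm x * norm A" for A :: "real^'m^'n"
  using norm_matrix_vector_le[of "transpose A" x] by (simp add: mult.commute)

lemma column_matrix_matrix_mult: "column j (A ** B) = A *v column j B"
  by (simp add: column_def matrix_matrix_mult_def matrix_vector_mult_def vec_eq_iff)

text \<open>Only vectors in the range of \<open>B\<close> matter, so that \<open>A\<close> may be a sketch.\<close>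

lemma norm_matrix_mult_le_range:
  fixes A :: "real^'k^'n" and B :: "real^'m^'k"
  assumes "\<And>x. norm (A *v (B *v x)) \<le> s * norm (B *v x)" "0 \<le> s"
  shows "norm (A ** B) \<le> s * norm B"
proof (rule power2_le_imp_le)
  have col: "column j B = B *v axis j 1" for j
    by (simp add: matrix_vector_mul_component column_def vec_eq_iff matrix_vector_mult_basis)
  have "(norm (A ** B))\<^sup>2 \<le> (\<Sum>j\<in>UNIV. (s * norm (column j B))\<^sup>2)"
    unfolding norm_matrix_sq_columns column_matrix_matrix_mult
    by (intro sum_mono power_mono) (auto simp: col assms)
  also have "\<dots> = (s * norm B)\<^sup>2"
    by (simp add: norm_matrix_sq_columns power_mult_distrib sum_distrib_left)
  finally show "(norm (A ** B))\<^sup>2 \<le> (s * norm B)\<^sup>2" .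
qed (use assms in simp)

lemma norm_matrix_mult_le: "norm (A ** B) \<le> norm A * norm B" for A :: "real^'k^'n" and B :: "real^'m^'k"
  by (rule norm_matrix_mult_le_range) (auto intro: norm_matrix_vector_le)

text \<open>Each of the \<open>CARD('m)\<close> columns is the image of a unit vector. This passage
  from a spectral to a Frobenius bound is the source of the factors \<open>sqrt m\<close>.\<close>

lemma norm_matrix_le_sqrt_card:
  fixes A :: "real^'m^'n"
  assumes "\<And>x. norm (A *v x) \<le> s * norm x" "0 \<le> s"
  shows "norm A \<le> sqrt (real CARD('m)) * s"
proof (rule power2_le_imp_le)
  have "norm (column j A) \<le> s" for j
    using assms(1)[of "axis j 1"] by (simp add: matrix_vector_mult_basis)
  then have "(norm A)\<^sup>2 \<le> (\<Sum>j\<in>(UNIV::'m set). s\<^sup>2)"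
    unfolding norm_matrix_sq_columns by (intro sum_mono power_mono) auto
  also have "\<dots> = (sqrt (real CARD('m)) * s)\<^sup>2"
    by (simp add: power_mult_distrib)
  finally show "(norm A)\<^sup>2 \<le> (sqrt (real CARD('m)) * s)\<^sup>2" .
qed (use assms in simp)

lemma onorm_matrix_vector: "norm (A *v x) \<le> onorm (\<lambda>x. A *v x) * norm x" for A :: "real^'m^'n"
  by (rule onorm) (rule matrix_vector_mul_bounded_linear)

lemma onorm_matrix_nonneg: "0 \<le> onorm (\<lambda>x. A *v x)" for A :: "real^'m^'n"
  by (rule onorm_pos_le) (rule matrix_vector_mul_bounded_linear)

text \<open>The transpose obeys the same spectral bound, so rows can be counted instead of columns.
  For the sketch \<open>S2\<close> this yields \<open>sqrt p2\<close> instead of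
  \<open>sqrt p1\<close>.\<close>

lemma norm_matrix_le_sqrt_card_rows:
  fixes A :: "real^'m^'n"
  shows "norm A \<le> sqrt (real CARD('n)) * onorm (\<lambda>x. A *v x)"
proof -
  let ?s = "onorm (\<lambda>x. A *v x)"
  have "norm (transpose A *v x) \<le> ?s * norm x" for x
  proof -
    let ?y = "transpose A *v x"
    have "(norm ?y)\<^sup>2 = x \<bullet> (A *v ?y)"
      by (metis dot_lmul_matrix power2_norm_eq_inner transpose_matrix_vector)
    also have "\<dots> \<le> norm x * (?s * norm ?y)"
      by (meson Cauchy_Schwarz_ineq2 abs_le_D1 mult_left_mono norm_ge_zero onorm_matrix_vector order_trans)
    finally have "norm ?y * norm ?y \<le> (?s * norm x) * norm ?y"
      by (simp add: power2_eq_square mult_ac)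
    then show ?thesis
      using onorm_matrix_nonneg[of A] by (cases "?y = 0") (simp_all add: mult_le_cancel_right)
  qed
  then have "norm (transpose A) \<le> sqrt (real CARD('n)) * ?s"
    by (intro norm_matrix_le_sqrt_card) (auto intro: onorm_matrix_nonneg)
  then show ?thesis by simp
qed

section \<open>Rounding error bounds in the Frobenius norm\<close>

lemma fl_matmul_error:
  fixes A :: "real^'k^'p" and B :: "real^'n^'k"
  assumes "fl_matmul u A B C" "0 \<le> gam u CARD('k)"
  shows "norm (C - A ** B) \<le> gam u CARD('k) * (norm A * norm B)"
proof -
  obtain D where D: "C = A ** B + D" "\<bar>D\<bar> \<le> gam u CARD('k) *\<^sub>R (\<bar>A\<bar> ** \<bar>B\<bar>)"
    using assms unfolding fl_matmul_def by auto
  have "norm D \<le> gam u CARD('k) * norm (\<bar>A\<bar> ** \<bar>B\<bar>)"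
    using norm_matrix_mono_abs[OF D(2)] assms(2) by simp
  also have "\<dots> \<le> gam u CARD('k) * (norm A * norm B)"
    using norm_matrix_mult_le[of "\<bar>A\<bar>" "\<bar>B\<bar>"] assms(2) by (intro mult_left_mono) auto
  finally show ?thesis using D(1) by simp
qed

text \<open>The perturbation of \<open>R\<close> differs from row to row. Row \<open>i\<close> of
  the residual is \<open>- ((Q $ i) v* D)\<close> with its own \<open>D\<close>, and summing squares
  over the rows gives one bound for the whole matrix.\<close>

lemma fl_trisolve_error:
  fixes V :: "real^'m^'n"
  assumes "fl_trisolve u V R Q" "0 \<le> gam u CARD('m)"
  shows "norm (Q ** R - V) \<le> gam u CARD('m) * (norm Q * norm R)"
proof (rule power2_le_imp_le)
  let ?g = "gam u CARD('m)"
  have "norm ((Q ** R - V) $ i) \<le> norm (Q $ i) * (?g * norm R)" for i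
  proof -
    obtain D where D: "(Q $ i) v* (R + D) = V $ i" "\<bar>D\<bar> \<le> ?g *\<^sub>R \<bar>R\<bar>"
      using assms unfolding fl_trisolve_def by auto
    have "(Q ** R) $ i = (Q $ i) v* R"
      by (simp add: matrix_matrix_mult_def vector_matrix_mult_def vec_eq_iff mult.commute)
    then have "(Q ** R - V) $ i = - ((Q $ i) v* D)"
      using D(1) by (simp add: vector_matrix_mult_def vec_eq_iff algebra_simps sum.distrib flip: D(1))
    then have "norm ((Q ** R - V) $ i) \<le> norm (Q $ i) * norm D"
      by (simp add: norm_vector_matrix_le)
    also have "norm D \<le> ?g * norm R"
      using norm_matrix_mono_abs[OF D(2)] assms(2) by simp
    finally show ?thesis by (simp add: mult_left_mono)
  qed
  then have "(norm (Q ** R - V))\<^sup>2 \<le> (\<Sum>i\<in>UNIV. (norm (Q $ i) * (?g * norm R))\<^sup>2)"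
    unfolding norm_matrix_sq_rows by (intro sum_mono power_mono) auto
  also have "\<dots> = (?g * (norm Q * norm R))\<^sup>2"
    by (simp add: norm_matrix_sq_rows[of Q] power_mult_distrib mult_ac sum_distrib_left)
  finally show "(norm (Q ** R - V))\<^sup>2 \<le> (?g * (norm Q * norm R))\<^sup>2" .
qed (use assms in simp)

text \<open>Stands in for the inverse of a triangular factor: later \<open>Q *v y\<close> is
  estimated by writing \<open>y = R *v x\<close> and comparing \<open>Q ** R\<close> with the
  factored matrix.\<close>

lemma inj_linear_bounded_below_surj:
  fixes R :: "real^'m^'m"
  assumes "\<And>x. x \<noteq> 0 \<Longrightarrow> R *v x \<noteq> 0"
  obtains x where "y = R *v x"
proof -
  have "inj ((*v) R)"
    using assms by (subst linear_injective_0) auto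
  then have "surj ((*v) R)"
    by (intro linear_injective_imp_surjective) auto
  then show ?thesis using that by (metis surjD)
qed

section \<open>Cholesky QR\<close>

lemma gam_bounds:
  assumes "real k * u \<le> h" "h < 1" "0 \<le> u"
  shows "0 \<le> gam u k" "gam u k \<le> real k * u / (1 - h)"
  using assms by (auto simp: gam_def intro!: divide_left_mono divide_nonneg_nonneg mult_pos_pos)

lemma inner_gram_matrix:
  fixes X :: "real^'m^'n"
  shows "x \<bullet> ((transpose X ** X) *v y) = (X *v x) \<bullet> (X *v y)"
  by (metis dot_lmul_matrix inner_commute matrix_vector_mul_assoc vector_transpose_matrix
      transpose_matrix_vector)

text \<open>The difference of the squares is the quadratic form of \<open>E\<close> at
  \<open>x\<close>, to which Cauchy-Schwarz applies.\<close>

lemma norm_normal_equations_diff: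
  fixes R :: "real^'m^'k" and X :: "real^'m^'n"
  assumes "transpose R ** R = transpose X ** X + E"
  shows "\<bar>(norm (R *v x))\<^sup>2 - (norm (X *v x))\<^sup>2\<bar> \<le> norm E * (norm x)\<^sup>2"
proof -
  have gram: "(norm (A *v x))\<^sup>2 = x \<bullet> ((transpose A ** A) *v x)" for A :: "real^'m^'l"
    by (simp add: power2_norm_eq_inner inner_gram_matrix)
  have "(norm (R *v x))\<^sup>2 - (norm (X *v x))\<^sup>2 = x \<bullet> (E *v x)"
    unfolding gram assms by (simp add: matrix_vector_mult_add_rdistrib inner_add_right)
  also have "\<bar>\<dots>\<bar> \<le> norm x * norm (E *v x)"
    by (rule Cauchy_Schwarz_ineq2)
  also have "\<dots> \<le> norm x * (norm E * norm x)"
    by (intro mult_left_mono norm_matrix_vector_le) auto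
  finally show ?thesis by (simp add: power2_eq_square mult_ac)
qed

lemma bounded_below_le_above:
  fixes X :: "real^'m^'n"
  assumes "\<And>x. s * norm x \<le> norm (X *v x)" "\<And>x. norm (X *v x) \<le> t * norm x"
  shows "s \<le> t"
  using order_trans[OF assms, of "axis undefined 1"] by simp

text \<open>\<open>s\<close> and \<open>t\<close> enclose the singular values of \<open>X\<close>,
  and \<open>g\<close> is the rounding error amplified by the squared condition bound.
  \<open>R *v x\<close> has nearly the norm of \<open>X *v x\<close>, and \<open>Q ** R\<close> is
  close to \<open>X\<close>, so \<open>Q\<close> is nearly an isometry. The constant 9/2, below 5,
  leaves room for a strict inequality at the end.\<close>

lemma fl_cholQR_near_orthonormal:
  fixes X :: "('n::finite, 'm::{finite,linorder}) rmat" and n m u s t g :: real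
  assumes alg: "fl_cholQR u X Q R"
    and nm: "n = real CARD('n)" "m = real CARD('m)" "2 \<le> m" "m \<le> n"
    and u: "0 < u" "n * m * u \<le> 1 / 12"
    and s: "0 < s" and lo: "\<And>x. s * norm x \<le> norm (X *v x)"
    and up: "\<And>x. norm (X *v x) \<le> t * norm x"
    and g: "g = (t / s)\<^sup>2 * (n * m + m * (m + 1)) * u" "g < 1 / 5"
  shows "\<bar>(norm (Q *v y))\<^sup>2 - (norm y)\<^sup>2\<bar> \<le> 9 / 2 * g * (norm y)\<^sup>2"
proof -
  obtain G E5 where G: "fl_matmul u (transpose X) X G"
    and E5: "transpose R ** R = G + E5" "\<bar>E5\<bar> \<le> gam u (CARD('m) + 1) *\<^sub>R (transpose \<bar>R\<bar> ** \<bar>R\<bar>)"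
    and tri: "fl_trisolve u X R Q"
    using alg unfolding fl_cholQR_def fl_cholesky_def by auto
  have st: "s \<le> t" using lo up by (rule bounded_below_le_above)
  have t: "0 < t" using s st by simp
  \<comment> \<open>Since \<open>m\<close> is at least 2, \<open>n * u\<close> is at most 1/24 and
    \<open>(m + 1) * u\<close> at most 1/16. Hence each \<open>gam\<close> is at most a fixed
    multiple of its first-order part.\<close>
  have "n * u * 2 \<le> n * u * m" using nm u by (intro mult_left_mono) auto
  then have nu: "n * u \<le> 1 / 24" using u(2) by (simp add: mult_ac)
  have mu: "m * u \<le> n * u" using nm u by (intro mult_right_mono) auto
  have m2: "m * m * u \<le> n * m * u" using nm u by (intro mult_right_mono) auto
  have "m * u * 2 \<le> m * u * m" using nm u by (intro mult_left_mono) auto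
  then have m1u: "m * (m + 1) * u \<le> 1 / 8" using m2 u by (simp add: algebra_simps)
  have "1 * u \<le> m * u / 2" using nm u by (simp add: field_simps)
  then have mu1: "(m + 1) * u \<le> 1 / 16" using mu nu by (simp add: algebra_simps)
  define gn gm gc where "gn = gam u CARD('n)" and "gm = gam u CARD('m)" and "gc = gam u (CARD('m) + 1)"
  have gn: "0 \<le> gn" "gn \<le> 24 / 23 * (n * u)"
    using gam_bounds[of "CARD('n)" u "1/24"] nu u nm by (auto simp: gn_def)
  have gm: "0 \<le> gm" "gm \<le> 24 / 23 * (m * u)"
    using gam_bounds[of "CARD('m)" u "1/24"] order_trans[OF mu nu] u nm by (auto simp: gm_def)
  have gc: "0 \<le> gc" "gc \<le> 16 / 15 * ((m + 1) * u)"
    using gam_bounds[of "CARD('m) + 1" u "1/16"] mu1 u nm by (auto simp: gc_def add.commute)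
  define P where "P = n * m + m * (m + 1)"
  have P: "0 < P" using nm by (auto simp: P_def intro!: add_pos_pos)
  have gs: "P * u * t\<^sup>2 = g * s\<^sup>2"
    using s by (simp add: g P_def power_divide)
  have g0: "0 < g" using P u s t by (simp add: g flip: P_def)
  \<comment> \<open>As \<open>m \<le> n\<close>, \<open>P\<close> contains \<open>m * m\<close>
    twice; this halves the bound for the triangular solve.\<close>
  have "m * m \<le> m * n" using nm by (intro mult_left_mono) auto
  moreover have "2 * P = 2 * (m * n) + 2 * (m * m) + 2 * m"
    by (simp add: P_def algebra_simps)
  ultimately have m2P: "m * m \<le> P / 2"
    using nm(3) by linarith
  have nX: "norm X \<le> sqrt m * t"
    unfolding nm(2) using up t by (intro norm_matrix_le_sqrt_card) auto
  define E4 where "E4 = G - transpose X ** X"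
  have "norm E4 \<le> gn * (norm X * norm X)"
    using fl_matmul_error[OF G] gn by (simp add: E4_def gn_def)
  also have "\<dots> \<le> gn * ((sqrt m * t) * (sqrt m * t))"
    using gn nX t nm by (intro mult_left_mono mult_mono) auto
  also have "\<dots> = gn * m * t\<^sup>2"
    using nm by (simp add: power2_eq_square)
  finally have E4: "norm E4 \<le> gn * m * t\<^sup>2" .
  \<comment> \<open>The Cholesky error is bounded in terms of \<open>R\<close> itself, so
    \<open>F\<close> will occur on both sides. Because \<open>gc * m\<close> is at most 2/15, the
    inequality can be solved for the square of \<open>F\<close>.\<close>
  define F where "F = norm R"
  have "norm E5 \<le> gc * norm (transpose \<bar>R\<bar> ** \<bar>R\<bar>)"
    using norm_matrix_mono_abs[OF E5(2)] gc by (simp add: gc_def)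
  also have "\<dots> \<le> gc * F\<^sup>2"
    using norm_matrix_mult_le[of "transpose \<bar>R\<bar>" "\<bar>R\<bar>"] gc
    by (intro mult_left_mono) (auto simp: F_def power2_eq_square)
  finally have E5n: "norm E5 \<le> gc * F\<^sup>2" .
  define h where "h = gn * m * t\<^sup>2 + gc * F\<^sup>2"
  have h0: "0 \<le> h" using gn gc nm by (simp add: h_def)
  have E: "norm (E4 + E5) \<le> h"
    using E4 E5n norm_triangle_ineq[of E4 E5] by (simp add: h_def)
  have "transpose R ** R = transpose X ** X + (E4 + E5)"
    using E5(1) by (simp add: E4_def)
  from norm_normal_equations_diff[OF this]
  have RX: "\<bar>(norm (R *v x))\<^sup>2 - (norm (X *v x))\<^sup>2\<bar> \<le> h * (norm x)\<^sup>2" for x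
    using mult_right_mono[OF E, of "(norm x)\<^sup>2"] by (meson order_trans zero_le_power2)
  have "norm (R *v x) \<le> sqrt (t\<^sup>2 + h) * norm x" for x
  proof (rule power2_le_imp_le)
    have "(norm (X *v x))\<^sup>2 \<le> (t * norm x)\<^sup>2" using up by (intro power_mono) auto
    then have "(norm (R *v x))\<^sup>2 \<le> (t\<^sup>2 + h) * (norm x)\<^sup>2"
      using RX[of x] by (simp add: power_mult_distrib algebra_simps abs_le_iff)
    then show "(norm (R *v x))\<^sup>2 \<le> (sqrt (t\<^sup>2 + h) * norm x)\<^sup>2"
      using h0 by (simp add: power_mult_distrib)
  qed (use h0 in simp)
  then have "F \<le> sqrt m * sqrt (t\<^sup>2 + h)"
    unfolding F_def nm(2) using h0 by (intro norm_matrix_le_sqrt_card) auto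
  then have "F\<^sup>2 \<le> (sqrt m * sqrt (t\<^sup>2 + h))\<^sup>2"
    by (rule power_mono) (simp add: F_def)
  also have "\<dots> = m * t\<^sup>2 + (gn * m) * (m * t\<^sup>2) + (gc * m) * F\<^sup>2"
    using h0 nm by (simp add: power_mult_distrib) (simp add: h_def algebra_simps)
  also have "\<dots> \<le> m * t\<^sup>2 + (2 / 23) * (m * t\<^sup>2) + (2 / 15) * F\<^sup>2"
  proof (intro add_mono mult_right_mono order_refl)
    have "gn * m \<le> 24 / 23 * (n * u) * m" using gn nm by (intro mult_right_mono) auto
    then show "gn * m \<le> 2 / 23" using u by (simp add: mult_ac)
    have "gc * m \<le> 16 / 15 * ((m + 1) * u) * m" using gc nm by (intro mult_right_mono) auto
    then show "gc * m \<le> 2 / 15" using m1u by (simp add: algebra_simps)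
  qed (use nm in auto)
  finally have "F\<^sup>2 \<le> m * t\<^sup>2 + (2 / 23) * (m * t\<^sup>2) + (2 / 15) * F\<^sup>2" .
  moreover have mt: "0 \<le> m * t\<^sup>2" using nm(3) by simp
  ultimately have F2: "F\<^sup>2 \<le> 63 / 50 * (m * t\<^sup>2)"
    by linarith
  \<comment> \<open>449/400 is a rational upper bound for the square root of 63/50.\<close>
  have F: "F \<le> 449 / 400 * (sqrt m * t)"
  proof (rule power2_le_imp_le)
    have "F\<^sup>2 \<le> (449 / 400)\<^sup>2 * (m * t\<^sup>2)"
      using F2 mt by (simp add: power_divide)
    also have "\<dots> = (449 / 400 * (sqrt m * t))\<^sup>2"
      unfolding power_mult_distrib using nm(3) by simp
    finally show "F\<^sup>2 \<le> (449 / 400 * (sqrt m * t))\<^sup>2" .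
  qed (use nm t in simp)
  have "h \<le> 24 / 23 * (n * u) * m * t\<^sup>2 + 16 / 15 * ((m + 1) * u) * (63 / 50 * (m * t\<^sup>2))"
    unfolding h_def using gn gc F2 nm u by (intro add_mono mult_mono mult_right_mono) auto
  also have "\<dots> \<le> 27 / 20 * (n * m * (u * t\<^sup>2)) + 27 / 20 * (m * (m + 1) * (u * t\<^sup>2))"
  proof (rule add_mono)
    show "24 / 23 * (n * u) * m * t\<^sup>2 \<le> 27 / 20 * (n * m * (u * t\<^sup>2))"
      using mult_right_mono[of "24/23" "27/20" "n * m * (u * t\<^sup>2)"] nm u by (simp add: mult_ac)
    have "16 / 15 * ((m + 1) * u) * (63 / 50 * (m * t\<^sup>2)) = 16 / 15 * (63 / 50) * (m * (m + 1) * (u * t\<^sup>2))"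
      by simp
    also have "\<dots> \<le> 27 / 20 * (m * (m + 1) * (u * t\<^sup>2))"
      using nm(3) u by (intro mult_right_mono) auto
    finally show "16 / 15 * ((m + 1) * u) * (63 / 50 * (m * t\<^sup>2)) \<le> 27 / 20 * (m * (m + 1) * (u * t\<^sup>2))" .
  qed
  also have "\<dots> = 27 / 20 * (P * u * t\<^sup>2)"
    by (simp add: P_def algebra_simps)
  finally have hs: "h \<le> 27 / 20 * g * s\<^sup>2" by (simp add: gs)
  have sx: "s\<^sup>2 * (norm x)\<^sup>2 \<le> (norm (X *v x))\<^sup>2" for x
    using power_mono[OF lo[of x], of 2] s by (simp add: power_mult_distrib)
  have RX': "\<bar>(norm (R *v x))\<^sup>2 - (norm (X *v x))\<^sup>2\<bar> \<le> 27 / 20 * g * (norm (X *v x))\<^sup>2" for x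
  proof -
    have "h * (norm x)\<^sup>2 \<le> 27 / 20 * g * s\<^sup>2 * (norm x)\<^sup>2"
      by (rule mult_right_mono[OF hs]) simp
    also have "\<dots> \<le> 27 / 20 * g * (norm (X *v x))\<^sup>2"
      using mult_left_mono[OF sx[of x], of "27 / 20 * g"] g0 by (simp add: mult_ac)
    finally show ?thesis using RX[of x] by linarith
  qed
  \<comment> \<open>As \<open>g < 1 / 5\<close>, the relative error \<open>27 / 20 * g\<close> is
    below 27/100. In \<open>XR1\<close>, 427/500 is a rational lower bound for the square root of
    73/100.\<close>
  have XR: "73 / 100 * (norm (X *v x))\<^sup>2 \<le> (norm (R *v x))\<^sup>2" for x
  proof -
    have "27 / 20 * g * (norm (X *v x))\<^sup>2 \<le> 27 / 100 * (norm (X *v x))\<^sup>2"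
      using g(2) by (intro mult_right_mono) auto
    then show ?thesis using RX'[of x] by linarith
  qed
  have XR1: "427 / 500 * norm (X *v x) \<le> norm (R *v x)" for x
  proof (rule power2_le_imp_le)
    have "(427 / 500 * norm (X *v x))\<^sup>2 \<le> 73 / 100 * (norm (X *v x))\<^sup>2"
      unfolding power_mult_distrib by (intro mult_right_mono) (auto simp: power2_eq_square)
    then show "(427 / 500 * norm (X *v x))\<^sup>2 \<le> (norm (R *v x))\<^sup>2"
      using XR[of x] by linarith
  qed simp
  have surj: "\<exists>x. y = R *v x" for y
  proof (rule inj_linear_bounded_below_surj)
    fix x :: "(real, 'm) vec" assume "x \<noteq> 0"
    then have "0 < s * norm x" using s by simp
    also have "\<dots> \<le> norm (X *v x)" by (rule lo)
    also have "\<dots> \<le> 500 / 427 * norm (R *v x)" using XR1[of x] by simp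
    finally show "R *v x \<noteq> 0" by auto
  qed auto
  \<comment> \<open>The error of the triangular solve involves the still unknown norm of
    \<open>Q\<close>. As for \<open>F\<close>, \<open>q\<close> is bounded in terms of itself and
    the inequality is then solved.\<close>
  define q where "q = onorm (\<lambda>x. Q *v x)"
  have q0: "0 \<le> q" unfolding q_def by (rule onorm_matrix_nonneg)
  have nQ: "norm Q \<le> sqrt m * q"
    unfolding nm(2) using q0 onorm_matrix_vector[of Q] by (intro norm_matrix_le_sqrt_card) (auto simp: q_def)
  define E6 where "E6 = Q ** R - X"
  have "norm E6 \<le> gm * (norm Q * F)"
    using fl_trisolve_error[OF tri] gm by (simp add: E6_def gm_def F_def)
  also have "\<dots> \<le> 24 / 23 * (m * u) * ((sqrt m * q) * (449 / 400 * (sqrt m * t)))"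
    using gm nQ F q0 nm u by (intro mult_mono) (auto simp: F_def)
  also have "\<dots> = 24 / 23 * (449 / 400) * (m * m * (u * t * q))"
    using nm by simp
  also have "\<dots> \<le> 293 / 250 * (P / 2 * (u * t * q))"
    using m2P nm u t q0 P by (intro mult_mono) auto
  finally have E6: "norm E6 \<le> 293 / 500 * (P * u * t * q)" by simp
  have E6x: "norm (E6 *v x) \<le> 293 / 500 * g * q * norm (X *v x)" for x
  proof -
    \<comment> \<open>Lowering one factor \<open>t\<close> to \<open>s\<close> allows
      \<open>s\<close> to be cancelled against \<open>g * s\<^sup>2\<close>.\<close>
    have "P * u * t * s \<le> P * u * t\<^sup>2"
      using st P u t by (simp add: power2_eq_square)
    then have Ps: "P * u * t \<le> g * s"
      using s gs by (simp add: power2_eq_square)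
    have "norm (E6 *v x) \<le> norm E6 * norm x" by (rule norm_matrix_vector_le)
    also have "\<dots> \<le> 293 / 500 * ((g * s) * q) * norm x"
      using E6 mult_right_mono[OF Ps q0] by (intro mult_right_mono) auto
    also have "\<dots> = 293 / 500 * g * q * (s * norm x)" by simp
    also have "\<dots> \<le> 293 / 500 * g * q * norm (X *v x)"
      using lo g0 q0 by (intro mult_left_mono) auto
    finally show ?thesis .
  qed
  have QR: "Q *v (R *v x) = X *v x + E6 *v x" for x
    by (simp add: E6_def matrix_vector_mul_assoc flip: matrix_vector_mult_add_rdistrib)
  have "norm (Q *v y) \<le> (1 + 293 / 2500 * q) * (500 / 427) * norm y" for y
  proof -
    obtain x where y: "y = R *v x" using surj by blast
    have "norm (Q *v y) \<le> norm (X *v x) + norm (E6 *v x)"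
      unfolding y QR by (rule norm_triangle_ineq)
    also have "\<dots> \<le> norm (X *v x) + 293 / 500 * (1 / 5) * q * norm (X *v x)"
    proof -
      have "293 / 500 * g * q * norm (X *v x) \<le> 293 / 500 * (1 / 5) * q * norm (X *v x)"
        using g(2) q0 by (intro mult_right_mono mult_left_mono) auto
      then show ?thesis using E6x[of x] by linarith
    qed
    also have "\<dots> = (1 + 293 / 2500 * q) * norm (X *v x)" by (simp add: algebra_simps)
    also have "\<dots> \<le> (1 + 293 / 2500 * q) * (500 / 427 * norm y)"
      using XR1[of x] q0 by (intro mult_left_mono) (auto simp: y)
    finally show ?thesis by (simp only: mult.assoc)
  qed
  then have "q \<le> (1 + 293 / 2500 * q) * (500 / 427)"
    unfolding q_def using q0 by (intro onorm_le) auto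
  then have q: "q \<le> 34 / 25" by simp
  obtain x where y: "y = R *v x" using surj by blast
  define N e where "N = norm (X *v x)" and "e = norm (E6 *v x)"
  have e: "0 \<le> e" "e \<le> 4 / 5 * g * N"
  proof -
    have "293 / 500 * g * q * N \<le> 293 / 500 * g * (34 / 25) * N"
      using q g0 by (intro mult_right_mono mult_left_mono) (auto simp: N_def)
    also have "\<dots> \<le> 4 / 5 * g * N"
      using g0 mult_nonneg_nonneg[of g N] by (simp add: N_def)
    finally show "e \<le> 4 / 5 * g * N" using E6x[of x] by (simp add: N_def e_def)
  qed (simp add: e_def)
  have tri1: "norm (Q *v y) \<le> N + e" "N - e \<le> norm (Q *v y)"
    unfolding y QR N_def e_def
    by (rule norm_triangle_ineq, rule norm_diff_ineq)
  have N0: "0 \<le> N" by (simp add: N_def)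
  have ee: "e\<^sup>2 \<le> 16 / 125 * g * N\<^sup>2"
  proof -
    have "e\<^sup>2 \<le> (4 / 5 * g * N)\<^sup>2" by (rule power_mono[OF e(2,1)])
    also have "\<dots> = (16 / 25 * g) * (g * N\<^sup>2)" by (simp add: power2_eq_square)
    also have "\<dots> \<le> (16 / 25 * g) * (1 / 5 * N\<^sup>2)"
      using g0 g(2) by (intro mult_left_mono mult_right_mono) auto
    finally show ?thesis by simp
  qed
  have Ne: "N * e \<le> 4 / 5 * g * N\<^sup>2"
    using mult_left_mono[OF e(2) N0] by (simp add: power2_eq_square mult_ac)
  have eN: "e \<le> N" using e g(2) mult_right_mono[of g "1/5" N] N0 by linarith
  have Q1: "(norm (Q *v y))\<^sup>2 \<le> N\<^sup>2 + 2 * (N * e) + e\<^sup>2"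
    using power_mono[OF tri1(1), of 2] by (simp add: power2_sum algebra_simps)
  have Q2: "N\<^sup>2 - 2 * (N * e) + e\<^sup>2 \<le> (norm (Q *v y))\<^sup>2"
    using power_mono[OF tri1(2), of 2] eN by (simp add: power2_diff algebra_simps)
  \<comment> \<open>The cross term and the square of the triangular solve error join the error of
    the normal equations. Replacing \<open>N\<close> by \<open>norm y\<close> costs 100/73, and the
    total constant, about 4.22, stays below 9/2.\<close>
  have "\<bar>(norm (Q *v y))\<^sup>2 - (norm y)\<^sup>2\<bar> \<le> 2 * (N * e) + e\<^sup>2 + 27 / 20 * g * N\<^sup>2"
    using Q1 Q2 RX'[of x] zero_le_power2[of e] unfolding y N_def[symmetric] by linarith
  also have "\<dots> \<le> (8 / 5 + 16 / 125 + 27 / 20) * (g * N\<^sup>2)"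
    using ee Ne by (simp add: algebra_simps)
  also have "\<dots> \<le> (8 / 5 + 16 / 125 + 27 / 20) * (g * (100 / 73 * (norm y)\<^sup>2))"
    using XR[of x] g0 by (intro mult_left_mono) (auto simp: N_def y)
  also have "\<dots> \<le> 9 / 2 * g * (norm y)\<^sup>2"
    using mult_right_mono[of "(8 / 5 + 16 / 125 + 27 / 20) * (100 / 73)" "9/2" "g * (norm y)\<^sup>2"] g0
    by (simp add: mult_ac)
  finally show ?thesis .
qed

section \<open>Randomized QR\<close>

text \<open>The sketches are fixed matrices here, controlled on the range of \<open>V\<close>.
  Rounding perturbs the sketched matrix by at most a tenth of \<open>a * lo\<close>, so
  \<open>norm (R *v x)\<close> lies between \<open>9 / 10 * a\<close> and \<open>11 / 10 * b\<close>
  times \<open>norm (V *v x)\<close>. Closeness of \<open>Q ** R\<close> to \<open>V\<close> then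
  gives both bounds.\<close>

lemma fl_randQR_well_conditioned:
  fixes V :: "('n::finite, 'm::{finite,linorder}) rmat"
    and S1 :: "('p1::finite, 'n) rmat" and S2 :: "('p2::finite, 'p1) rmat"
    and n m p1 p2 u a b b1 lo up :: real
  assumes alg: "fl_randQR u V S1 S2 Q R"
    and dims: "n = real CARD('n)" "m = real CARD('m)" "p1 = real CARD('p1)" "p2 = real CARD('p2)"
      "2 \<le> m" "m \<le> p2" "p2 \<le> p1" "p1 \<le> n"
    and u: "0 < u" "n * m * u \<le> 1 / 12" "p1 * sqrt p2 * u \<le> 1 / 12"
    and ab: "0 < a" "a \<le> b" "0 \<le> b1" "0 < lo"
    and Vlo: "\<And>x. lo * norm x \<le> norm (V *v x)"
    and Vup: "\<And>x. norm (V *v x) \<le> up * norm x"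
    and S1: "\<And>x. norm (S1 *v (V *v x)) \<le> b1 * norm (V *v x)"
    and Slo: "\<And>x. a * norm (V *v x) \<le> norm (S2 *v (S1 *v (V *v x)))"
    and Sup: "\<And>x. norm (S2 *v (S1 *v (V *v x))) \<le> b * norm (V *v x)"
    and \<delta>: "383 * (b * p2 * (m * sqrt m) + sqrt m * onorm (\<lambda>x. S2 *v x) *
             (p1 * sqrt p2 * b1 + n * norm S1)) * u * up \<le> a * lo"
  shows "10 / 11 * (1 / b - 3 / 25 / a) * norm y \<le> norm (Q *v y)"
    and "norm (Q *v y) \<le> 6 / 5 / a * norm y"
proof -
  obtain W1 W where W1: "fl_matmul u S1 V W1" and W: "fl_matmul u S2 W1 W"
    and hh: "fl_householder u W R" and tri: "fl_trisolve u V R Q"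
    using alg unfolding fl_randQR_def by auto
  obtain Qt :: "('p2, 'm) rmat" and E2 where Qt: "transpose Qt ** Qt = mat 1"
    and WQ: "W + E2 = Qt ** R"
    and E2: "\<And>j. norm (column j E2) \<le> gam u (29 * CARD('p2) * CARD('m)) * norm (column j W)"
    using hh unfolding fl_householder_def by auto
  have loup: "lo \<le> up" using Vlo Vup by (rule bounded_below_le_above)
  have b: "0 < b" "0 < up" using ab loup by auto
  have "n * u * 2 \<le> n * u * m" using dims u by (intro mult_left_mono) auto
  then have nu: "n * u \<le> 1 / 24" using u(2) by (simp add: mult_ac)
  have mu: "m * u \<le> 1 / 24"
    using nu mult_right_mono[of m n u] dims u by linarith
  have p1u: "p1 * u \<le> 1 / 24"
    using nu mult_right_mono[of p1 n u] dims u by linarith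
  define N1 N2 where "N1 = norm S1" and "N2 = onorm (\<lambda>x. S2 *v x)"
  have N0: "0 \<le> N1" "0 \<le> N2" by (auto simp: N1_def N2_def onorm_matrix_nonneg)
  define v where "v = sqrt m * up"
  have v: "0 < v" using dims b by (simp add: v_def)
  \<comment> \<open>The two summands of the hypothesis \<open>\<delta>\<close>: \<open>T1\<close>
    will absorb the Householder and triangular solve errors, \<open>T2\<close> the errors of the
    sketching products.\<close>
  define T1 T2 where "T1 = b * p2 * m * u * v"
    and "T2 = N2 * v * u * (n * N1 + p1 * sqrt p2 * b1)"
  have T0: "0 \<le> T1" "0 \<le> T2" using b v u dims N0 ab by (auto simp: T1_def T2_def)
  have T: "383 * (T1 + T2) \<le> a * lo"
    using \<delta> by (simp add: T1_def T2_def v_def N1_def N2_def algebra_simps)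
  \<comment> \<open>Smallness of this quantity is extracted from \<open>\<delta>\<close>: since
    \<open>a * lo\<close> is at most \<open>b * up\<close>, the factor \<open>b * up\<close>
    cancels.\<close>
  have p2mu: "p2 * m * sqrt m * u \<le> 1 / 383"
  proof -
    have "(383 * (p2 * m * sqrt m * u)) * (b * up) = 383 * T1"
      by (simp add: T1_def v_def)
    also have "\<dots> \<le> a * lo" using T T0 by simp
    also have "\<dots> \<le> 1 * (b * up)" using ab loup b by (auto intro: mult_mono)
    finally show ?thesis using b by (simp add: mult_le_cancel_right)
  qed
  have sqrt1: "1 \<le> sqrt m" using dims by simp
  have "p2 * m * u * 1 \<le> p2 * m * u * sqrt m"
    using sqrt1 dims u by (intro mult_left_mono) auto
  also have "\<dots> \<le> 1 / 383" using p2mu by (simp only: mult_ac)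
  finally have p2m: "p2 * m * u \<le> 1 / 383" by simp
  define gn gm gp gh where "gn = gam u CARD('n)" and "gm = gam u CARD('m)"
    and "gp = gam u CARD('p1)" and "gh = gam u (29 * CARD('p2) * CARD('m))"
  have gn: "0 \<le> gn" "gn \<le> 24 / 23 * (n * u)"
    using gam_bounds[of "CARD('n)" u "1/24"] nu u dims by (auto simp: gn_def)
  have gm: "0 \<le> gm" "gm \<le> 24 / 23 * (m * u)"
    using gam_bounds[of "CARD('m)" u "1/24"] mu u dims by (auto simp: gm_def)
  have gp: "0 \<le> gp" "gp \<le> 24 / 23 * (p1 * u)"
    using gam_bounds[of "CARD('p1)" u "1/24"] p1u u dims by (auto simp: gp_def)
  \<comment> \<open>The denominator of \<open>gh\<close> is at least 1 - 29/383, and 29 / (1 -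
    29/383) is just below 157/5.\<close>
  have gh: "0 \<le> gh" "gh \<le> 157 / 5 * (p2 * m * u)"
  proof -
    have *: "real (29 * CARD('p2) * CARD('m)) * u \<le> 29 / 383"
      using p2m dims by (simp add: mult_ac)
    show "0 \<le> gh" unfolding gh_def using * u by (intro gam_bounds(1)[of _ u "29/383"]) auto
    have "gh \<le> real (29 * CARD('p2) * CARD('m)) * u / (1 - 29 / 383)"
      unfolding gh_def using * u by (intro gam_bounds(2)) auto
    also have "\<dots> = (29 / (1 - 29 / 383)) * (p2 * m * u)" using dims by simp
    also have "\<dots> \<le> 157 / 5 * (p2 * m * u)" using dims u by (intro mult_right_mono) auto
    finally show "gh \<le> 157 / 5 * (p2 * m * u)" .
  qed
  have nV: "norm V \<le> v"
    unfolding v_def dims(2) using Vup b by (intro norm_matrix_le_sqrt_card) auto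
  have S1V: "norm (S1 ** V) \<le> b1 * v"
    using norm_matrix_mult_le_range[of S1 V b1] S1 mult_left_mono[OF nV ab(3)] ab
    by (meson order_trans)
  \<comment> \<open>\<open>D1\<close> and \<open>D2\<close> are the local errors of the two
    products. The first is propagated through \<open>S2\<close>, so the total sketching error is
    \<open>E1 = D2 + S2 ** D1\<close>.\<close>
  define D1 D2 E1 where "D1 = W1 - S1 ** V" and "D2 = W - S2 ** W1" and "E1 = W - S2 ** (S1 ** V)"
  have "norm D1 \<le> gn * (N1 * norm V)"
    using fl_matmul_error[OF W1] gn by (simp add: D1_def gn_def N1_def)
  also have "\<dots> \<le> gn * (N1 * v)"
    using gn N0 nV by (intro mult_left_mono) auto
  finally have D1: "norm D1 \<le> gn * (N1 * v)" .
  have W1n: "norm W1 \<le> (b1 + gn * N1) * v"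
    using norm_triangle_ineq[of D1 "S1 ** V"] D1 S1V by (simp add: D1_def algebra_simps)
  have "norm D2 \<le> gp * (norm S2 * norm W1)"
    using fl_matmul_error[OF W] gp by (simp add: D2_def gp_def)
  also have "\<dots> \<le> gp * ((sqrt p2 * N2) * ((b1 + gn * N1) * v))"
    using W1n gp N0 norm_matrix_le_sqrt_card_rows[of S2] dims unfolding N2_def
    by (intro mult_left_mono mult_mono) auto
  finally have D2: "norm D2 \<le> gp * sqrt p2 * N2 * (b1 + gn * N1) * v" by (simp add: mult_ac)
  have "norm (S2 ** D1) \<le> N2 * norm D1"
    using N0 onorm_matrix_vector[of S2] by (intro norm_matrix_mult_le_range) (auto simp: N2_def)
  also have "\<dots> \<le> N2 * (gn * (N1 * v))"
    using D1 N0 by (intro mult_left_mono)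
  finally have SD1: "norm (S2 ** D1) \<le> N2 * (gn * (N1 * v))" .
  have W1eq: "S2 ** W1 = S2 ** (S1 ** V) + S2 ** D1"
    by (simp add: D1_def flip: matrix_add_ldistrib)
  have E1eq: "E1 = D2 + S2 ** D1"
    by (simp add: E1_def D2_def W1eq)
  \<comment> \<open>The bound on \<open>p1 * sqrt p2 * u\<close> limits \<open>gp * sqrt p2\<close>
    to 2/23, so the compounding of the two rounding errors costs only the factor 25/23.\<close>
  have gp2: "gp * sqrt p2 \<le> 24 / 23 * (p1 * sqrt p2 * u)"
    using mult_right_mono[OF gp(2), of "sqrt p2"] dims by (simp add: mult_ac)
  have gp3: "gp * sqrt p2 \<le> 2 / 23" using gp2 u by linarith
  have i1: "gn * N1 \<le> 24 / 23 * (n * u) * N1"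
    using gn N0 by (intro mult_right_mono)
  have i2: "gn * N1 * (1 + gp * sqrt p2) \<le> 24 / 23 * (n * u) * N1 * (25 / 23)"
    by (rule mult_mono[OF i1]) (use gp3 gp N0 dims u in auto)
  have i3: "gp * sqrt p2 * b1 \<le> 24 / 23 * (p1 * sqrt p2 * u) * b1"
    by (rule mult_right_mono[OF gp2 ab(3)])
  have "norm E1 \<le> N2 * v * (gn * N1 * (1 + gp * sqrt p2) + gp * sqrt p2 * b1)"
    using norm_triangle_ineq[of D2 "S2 ** D1"] D2 SD1 by (simp add: E1eq algebra_simps)
  also have "\<dots> \<le> N2 * v * (24 / 23 * (n * u) * N1 * (25 / 23) + 24 / 23 * (p1 * sqrt p2 * u) * b1)"
    by (rule mult_left_mono[OF add_mono[OF i2 i3]]) (use N0 v in simp)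
  also have "\<dots> \<le> N2 * v * (6 / 5 * (n * u * N1) + 6 / 5 * (p1 * sqrt p2 * u * b1))"
  proof (rule mult_left_mono[OF add_mono])
    have "0 \<le> n * u * N1" "0 \<le> p1 * sqrt p2 * u * b1" using N0 dims u ab by auto
    then show "24 / 23 * (n * u) * N1 * (25 / 23) \<le> 6 / 5 * (n * u * N1)"
      "24 / 23 * (p1 * sqrt p2 * u) * b1 \<le> 6 / 5 * (p1 * sqrt p2 * u * b1)"
      by (simp_all add: mult_ac)
  qed (use N0 v in simp)
  also have "\<dots> = 6 / 5 * T2" by (simp add: T2_def algebra_simps)
  finally have E1: "norm E1 \<le> 6 / 5 * T2" .
  have SS: "norm (S2 ** (S1 ** V)) \<le> b * v"
  proof -
    have "norm ((S2 ** S1) ** V) \<le> b * norm V"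
      using Sup b by (intro norm_matrix_mult_le_range) (auto simp: matrix_vector_mul_assoc matrix_mul_assoc)
    also have "\<dots> \<le> b * v" using nV b by simp
    finally show ?thesis by (simp add: matrix_mul_assoc)
  qed
  have Wn: "norm W \<le> b * v + 6 / 5 * T2"
    using norm_triangle_ineq[of E1 "S2 ** (S1 ** V)"] E1 SS by (simp add: E1_def)
  have "norm E2 \<le> gh * norm W"
  proof (rule power2_le_imp_le)
    have "(norm E2)\<^sup>2 \<le> (\<Sum>j\<in>UNIV. (gh * norm (column j W))\<^sup>2)"
      unfolding norm_matrix_sq_columns using E2 by (intro sum_mono power_mono) (auto simp: gh_def)
    also have "\<dots> = (gh * norm W)\<^sup>2"
      by (simp add: norm_matrix_sq_columns power_mult_distrib sum_distrib_left)
    finally show "(norm E2)\<^sup>2 \<le> (gh * norm W)\<^sup>2" .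
  qed (use gh in simp)
  also have "\<dots> \<le> 157 / 5 * (p2 * m * u) * (b * v + 6 / 5 * T2)"
    using gh Wn b v T0 dims u by (intro mult_mono) auto
  also have "\<dots> = 157 / 5 * T1 + 157 / 5 * (6 / 5) * ((p2 * m * u) * T2)"
    by (simp add: T1_def algebra_simps)
  also have "\<dots> \<le> 157 / 5 * T1 + 157 / 5 * (6 / 5) * (1 / 383 * T2)"
    using p2m T0 by (intro add_left_mono mult_left_mono mult_right_mono) auto
  also have "\<dots> \<le> 157 / 5 * T1 + T2" using T0 by simp
  finally have E2n: "norm E2 \<le> 157 / 5 * T1 + T2" .
  define E where "E = E1 + E2"
  \<comment> \<open>The coefficients 157/5 of \<open>T1\<close> and 11/5 of \<open>T2\<close> are
    both below 383/10.\<close>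
  have E: "norm E \<le> 1 / 10 * (a * lo)"
    using norm_triangle_ineq[of E1 E2] E1 E2n T T0 by (simp add: E_def)
  have Ex: "norm (E *v x) \<le> 1 / 10 * a * norm (V *v x)" for x
  proof -
    have "norm (E *v x) \<le> norm E * norm x" by (rule norm_matrix_vector_le)
    also have "\<dots> \<le> 1 / 10 * (a * lo) * norm x" using E by (rule mult_right_mono) simp
    also have "\<dots> \<le> 1 / 10 * a * norm (V *v x)"
      using mult_left_mono[OF Vlo[of x], of "1 / 10 * a"] ab by simp
    finally show ?thesis .
  qed
  \<comment> \<open>\<open>Qt\<close> has orthonormal columns, so applying it to
    \<open>R *v x\<close> preserves the norm.\<close>
  have QtR: "norm (R *v x) = norm (S2 *v (S1 *v (V *v x)) + E *v x)" for x
  proof -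
    have iso: "norm (Qt *v z) = norm z" for z
      by (metis Qt dot_lmul_matrix matrix_vector_mul_assoc matrix_vector_mul_lid norm_eq_sqrt_inner
          vector_transpose_matrix)
    have "S2 ** (S1 ** V) + E = Qt ** R" by (simp add: E_def E1_def flip: WQ)
    then have "Qt *v (R *v x) = S2 *v (S1 *v (V *v x)) + E *v x"
      by (metis matrix_vector_mul_assoc matrix_vector_mult_add_rdistrib)
    then show ?thesis using iso by metis
  qed
  have Rlo: "9 / 10 * a * norm (V *v x) \<le> norm (R *v x)" for x
    using norm_diff_ineq[of "S2 *v (S1 *v (V *v x))" "E *v x"] Slo[of x] Ex[of x]
    unfolding QtR by linarith
  have Rup: "norm (R *v x) \<le> 11 / 10 * b * norm (V *v x)" for x
    using norm_triangle_ineq[of "S2 *v (S1 *v (V *v x))" "E *v x"] Sup[of x] Ex[of x]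
      mult_right_mono[OF ab(2), of "norm (V *v x)"]
    unfolding QtR by simp
  have "norm (R *v x) \<le> 11 / 10 * b * up * norm x" for x
  proof -
    have "11 / 10 * b * norm (V *v x) \<le> 11 / 10 * b * (up * norm x)"
      using Vup b by (intro mult_left_mono) auto
    then show ?thesis using Rup[of x] by (simp only: mult.assoc)
  qed
  then have Rn: "norm R \<le> sqrt m * (11 / 10 * b * up)"
    unfolding dims(2) using b by (intro norm_matrix_le_sqrt_card) auto
  define q where "q = onorm (\<lambda>x. Q *v x)"
  have q0: "0 \<le> q" unfolding q_def by (rule onorm_matrix_nonneg)
  have nQ: "norm Q \<le> sqrt m * q"
    unfolding dims(2) using q0 onorm_matrix_vector[of Q] by (intro norm_matrix_le_sqrt_card) (auto simp: q_def)
  define E3 where "E3 = Q ** R - V"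
  \<comment> \<open>Since \<open>m \<le> p2\<close>, the triangular solve error is absorbed by
    \<open>T1\<close>.\<close>
  have m2: "m * m * u * b * up \<le> a * lo / 383"
  proof -
    have "m * 1 \<le> p2 * sqrt m" using dims sqrt1 by (intro mult_mono) auto
    then have "m * m * u * b * up \<le> (p2 * sqrt m) * m * u * b * up"
      using dims u b by (intro mult_right_mono) auto
    also have "\<dots> = T1" by (simp add: T1_def v_def)
    finally show ?thesis using T T0 by simp
  qed
  have "norm E3 \<le> gm * (norm Q * norm R)"
    using fl_trisolve_error[OF tri] gm by (simp add: E3_def gm_def)
  also have "\<dots> \<le> 24 / 23 * (m * u) * ((sqrt m * q) * (sqrt m * (11 / 10 * b * up)))"
    using gm nQ Rn q0 dims u by (intro mult_mono) auto
  also have "\<dots> = 24 / 23 * (11 / 10) * ((m * m * u * b * up) * q)"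
    using dims by simp
  also have "\<dots> \<le> 24 / 23 * (11 / 10) * ((a * lo / 383) * q)"
    using m2 q0 by (intro mult_left_mono mult_right_mono) auto
  also have "\<dots> \<le> 1 / 250 * (a * lo * q)"
    using mult_right_mono[of "24 / 23 * (11 / 10) / 383" "1/250" "a * lo * q"] ab q0 by simp
  finally have E3: "norm E3 \<le> 1 / 250 * (a * lo * q)" .
  have E3x: "norm (E3 *v x) \<le> 1 / 200 * q * norm (R *v x)" for x
  proof -
    have "norm (E3 *v x) \<le> norm E3 * norm x" by (rule norm_matrix_vector_le)
    also have "\<dots> \<le> 1 / 250 * (a * lo * q) * norm x" using E3 by (rule mult_right_mono) simp
    also have "\<dots> = 1 / 250 * (a * q) * (lo * norm x)" by simp
    also have "\<dots> \<le> 1 / 250 * (a * q) * norm (V *v x)"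
      using Vlo ab q0 by (intro mult_left_mono) auto
    also have "\<dots> = 1 / 225 * q * (9 / 10 * a * norm (V *v x))" by simp
    also have "\<dots> \<le> 1 / 225 * q * norm (R *v x)"
      using Rlo q0 by (intro mult_left_mono) auto
    also have "\<dots> \<le> 1 / 200 * q * norm (R *v x)"
      using q0 by (intro mult_right_mono) auto
    finally show ?thesis .
  qed
  have QR: "Q *v (R *v x) = V *v x + E3 *v x" for x
    by (simp add: E3_def matrix_vector_mul_assoc flip: matrix_vector_mult_add_rdistrib)
  have surj: "\<exists>x. y = R *v x" for y
  proof (rule inj_linear_bounded_below_surj)
    fix x :: "(real, 'm) vec" assume "x \<noteq> 0"
    then have "0 < 9 / 10 * a * (lo * norm x)" using ab by simp
    also have "\<dots> \<le> 9 / 10 * a * norm (V *v x)" using Vlo ab by (intro mult_left_mono) auto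
    also have "\<dots> \<le> norm (R *v x)" by (rule Rlo)
    finally show "R *v x \<noteq> 0" by auto
  qed auto
  \<comment> \<open>Solving for \<open>q\<close> gives the constant (10/9) * (200/199) = 2000/1791,
    below 6/5.\<close>
  have "norm (Q *v y) \<le> (10 / 9 / a + 1 / 200 * q) * norm y" for y
  proof -
    obtain x where y: "y = R *v x" using surj by blast
    have "norm (Q *v y) \<le> norm (V *v x) + norm (E3 *v x)"
      unfolding y QR by (rule norm_triangle_ineq)
    also have "norm (V *v x) \<le> 10 / 9 / a * norm y"
      using Rlo[of x] ab by (simp add: y field_simps)
    finally show ?thesis using E3x[of x] by (simp add: y algebra_simps)
  qed
  then have "q \<le> 10 / 9 / a + 1 / 200 * q"
    unfolding q_def using q0 ab by (intro onorm_le) auto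
  then have "q \<le> 2000 / 1791 / a" by simp
  also have "\<dots> \<le> 6 / 5 / a" using ab by (intro divide_right_mono) auto
  finally have q: "q \<le> 6 / 5 / a" .
  show "norm (Q *v y) \<le> 6 / 5 / a * norm y"
    using onorm_matrix_vector[of Q y] mult_right_mono[OF q, of "norm y"] by (simp add: q_def)
  obtain x where y: "y = R *v x" using surj by blast
  \<comment> \<open>The error term costs only \<open>6 / 1000 / a\<close>. The larger
    \<open>10 / 11 * (3 / 25 / a)\<close> makes the quotient of the two bounds equal to
    \<open>33 / (25 * (a / b) - 3)\<close>.\<close>
  have "10 / 11 * (1 / b - 3 / 25 / a) * norm y \<le> (10 / 11 / b - 1 / 200 * (6 / 5 / a)) * norm y"
    using ab by (intro mult_right_mono) (auto simp: field_simps)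
  also have "\<dots> = 10 / 11 / b * norm y - 1 / 200 * (6 / 5 / a) * norm y"
    by (simp add: algebra_simps)
  also have "\<dots> \<le> norm (V *v x) - norm (E3 *v x)"
  proof (rule diff_mono)
    show "10 / 11 / b * norm y \<le> norm (V *v x)"
      using Rup[of x] b by (simp add: y field_simps)
    have "norm (E3 *v x) \<le> 1 / 200 * q * norm y" using E3x by (simp add: y)
    also have "\<dots> \<le> 1 / 200 * (6 / 5 / a) * norm y"
      using q by (intro mult_right_mono mult_left_mono) auto
    finally show "norm (E3 *v x) \<le> 1 / 200 * (6 / 5 / a) * norm y" .
  qed
  also have "\<dots> \<le> norm (Q *v y)"
    unfolding y QR by (rule norm_diff_ineq)
  finally show "10 / 11 * (1 / b - 3 / 25 / a) * norm y \<le> norm (Q *v y)" .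
qed

section \<open>Singular values\<close>

lemma singular_value_norm:
  fixes X :: "real^'m^'n"
  assumes "s \<in> singular_values X"
  obtains v where "v \<noteq> 0" "norm (X *v v) = s * norm v"
proof -
  obtain v where v: "v \<noteq> 0" "(transpose X ** X) *v v = s\<^sup>2 *\<^sub>R v" and s: "0 \<le> s"
    using assms unfolding singular_values_def by auto
  have "(norm (X *v v))\<^sup>2 = (s * norm v)\<^sup>2"
    using inner_gram_matrix[of v X v] v(2)
    by (simp add: power2_norm_eq_inner power_mult_distrib)
  then have "norm (X *v v) = s * norm v" using s by (simp add: power2_eq_iff_nonneg)
  with v that show ?thesis by blast
qed

text \<open>Gives \<open>Max\<close> and \<open>Min\<close> in \<open>sigma_max\<close> and
  \<open>sigma_min\<close> their meaning. Eigenvectors of the symmetric Gram matrix for different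
  eigenvalues are orthogonal, and a pairwise orthogonal set is finite.\<close>

lemma finite_singular_values: "finite (singular_values X)" for X :: "real^'m^'n"
proof -
  have "\<exists>v. v \<noteq> 0 \<and> (transpose X ** X) *v v = s\<^sup>2 *\<^sub>R v" if "s \<in> singular_values X" for s
    using that unfolding singular_values_def by auto
  then obtain w where w: "\<And>s. s \<in> singular_values X \<Longrightarrow> w s \<noteq> 0 \<and> (transpose X ** X) *v w s = s\<^sup>2 *\<^sub>R w s"
    by metis
  have orth: "w s \<bullet> w r = 0" if "s \<in> singular_values X" "r \<in> singular_values X" "s \<noteq> r" for s r
  proof -
    have "s\<^sup>2 * (w s \<bullet> w r) = w r \<bullet> ((transpose X ** X) *v w s)"
      using w[OF that(1)] by (simp add: inner_commute)
    also have "\<dots> = w s \<bullet> ((transpose X ** X) *v w r)"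
      by (simp add: inner_gram_matrix inner_commute)
    also have "\<dots> = r\<^sup>2 * (w s \<bullet> w r)"
      using w[OF that(2)] by simp
    finally have "s\<^sup>2 = r\<^sup>2 \<or> w s \<bullet> w r = 0" by (metis mult_cancel_right)
    moreover have "s\<^sup>2 \<noteq> r\<^sup>2"
      using that by (simp add: singular_values_def power2_eq_iff_nonneg)
    ultimately show ?thesis by simp
  qed
  have "inj_on w (singular_values X)"
    using orth w by (metis inj_onI inner_eq_zero_iff)
  moreover have "pairwise orthogonal (w ` singular_values X)"
    using orth by (auto simp: pairwise_def orthogonal_def)
  then have "finite (w ` singular_values X)" by (rule pairwise_orthogonal_imp_finite)
  ultimately show ?thesis by (metis finite_imageD)
qed

text \<open>Perturbing \<open>v\<close> in the direction of the residual \<open>z\<close> changes the Rayleigh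
  quotient to first order unless \<open>z = 0\<close>; the sign \<open>e\<close> treats minima and maxima
  together.\<close>

lemma rayleigh_extremum_eigenvector:
  fixes X :: "real^'m^'n" and l e :: real
  assumes ext: "\<And>w. 0 \<le> e * ((norm (X *v w))\<^sup>2 - l * (norm w)\<^sup>2)"
    and v: "(norm (X *v v))\<^sup>2 = l * (norm v)\<^sup>2" and e: "e = 1 \<or> e = -1"
  shows "(transpose X ** X) *v v = l *\<^sub>R v"
proof (rule ccontr)
  define z where "z = (transpose X ** X) *v v - l *\<^sub>R v"
  assume "\<not> ?thesis"
  then have z: "0 < (norm z)\<^sup>2" by (simp add: z_def)
  define C where "C = (norm (X *v z))\<^sup>2 - l * (norm z)\<^sup>2"
  \<comment> \<open>The step is short enough for the linear term to outweigh the quadratic one; the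
    \<open>+ 1\<close> covers \<open>C = 0\<close>.\<close>
  define t where "t = (norm z)\<^sup>2 / (\<bar>C\<bar> + 1)"
  have t: "0 < t" unfolding t_def using z by (intro divide_pos_pos) auto
  have "z \<bullet> z = (X *v z) \<bullet> (X *v v) - l * (z \<bullet> v)"
    by (subst (2) z_def) (simp add: inner_diff_right inner_gram_matrix)
  then have zz: "(X *v v) \<bullet> (X *v z) - l * (v \<bullet> z) = (norm z)\<^sup>2"
    by (simp add: power2_norm_eq_inner inner_commute)
  have sq: "(norm (a - c *\<^sub>R b))\<^sup>2 = (norm a)\<^sup>2 - 2 * c * (a \<bullet> b) + c\<^sup>2 * (norm b)\<^sup>2"
    for a b :: "real^'k" and c
    unfolding power2_norm_eq_inner
    by (simp add: inner_diff_left inner_diff_right inner_commute power2_eq_square algebra_simps)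
  have "(norm (X *v (v - (e * t) *\<^sub>R z)))\<^sup>2 - l * (norm (v - (e * t) *\<^sub>R z))\<^sup>2
      = - 2 * (e * t) * ((X *v v) \<bullet> (X *v z) - l * (v \<bullet> z)) + (e * t)\<^sup>2 * C"
    unfolding matrix_vector_mult_diff_distrib matrix_vector_mult_scaleR sq v C_def
    by (simp add: algebra_simps)
  then have "0 \<le> e * (- 2 * (e * t) * (norm z)\<^sup>2 + (e * t)\<^sup>2 * C)"
    using ext[of "v - (e * t) *\<^sub>R z"] zz by simp
  also have "\<dots> = t * (- 2 * (norm z)\<^sup>2 + t * (e * C))"
    using e by (auto simp: power2_eq_square algebra_simps)
  finally have "2 * (norm z)\<^sup>2 \<le> t * (e * C)"
    using t by (simp add: zero_le_mult_iff)
  also have "\<dots> \<le> t * (\<bar>C\<bar> + 1)"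
    using t e by (intro mult_left_mono) auto
  also have "\<dots> = (norm z)\<^sup>2" by (simp add: t_def)
  finally show False using z by simp
qed

text \<open>Homogeneity extends the extremal property from unit vectors to all vectors. Multiplying
  by the nonnegative sum of the two norms turns it into a statement on squares, as
  \<open>rayleigh_extremum_eigenvector\<close> requires.\<close>

lemma singular_value_of_extremum:
  fixes X :: "real^'m^'n" and e :: real
  assumes v: "norm v = 1" and e: "e = 1 \<or> e = -1"
    and ext: "\<And>w. norm w = 1 \<Longrightarrow> 0 \<le> e * (norm (X *v w) - norm (X *v v))"
  shows "norm (X *v v) \<in> singular_values X"
    and "0 \<le> e * (norm (X *v w) - norm (X *v v) * norm w)"
proof -
  show *: "0 \<le> e * (norm (X *v w) - norm (X *v v) * norm w)" for w
  proof (cases "w = 0")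
    case False
    have "0 \<le> norm w * (e * (norm (X *v ((1 / norm w) *\<^sub>R w)) - norm (X *v v)))"
      using False by (intro mult_nonneg_nonneg ext) auto
    also have "\<dots> = e * (norm (X *v w) - norm (X *v v) * norm w)"
      using False by (simp add: matrix_vector_mult_scaleR algebra_simps)
    finally show ?thesis .
  qed simp
  have "(transpose X ** X) *v v = (norm (X *v v))\<^sup>2 *\<^sub>R v"
  proof (rule rayleigh_extremum_eigenvector[OF _ _ e])
    fix w
    have "0 \<le> (norm (X *v w) + norm (X *v v) * norm w) * (e * (norm (X *v w) - norm (X *v v) * norm w))"
      by (intro mult_nonneg_nonneg * add_nonneg_nonneg) auto
    then show "0 \<le> e * ((norm (X *v w))\<^sup>2 - (norm (X *v v))\<^sup>2 * (norm w)\<^sup>2)"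
      by (simp add: power2_eq_square algebra_simps)
  qed (simp add: v)
  then show "norm (X *v v) \<in> singular_values X"
    using v by (auto simp: singular_values_def intro!: exI[of _ v])
qed

text \<open>On the compact unit sphere \<open>norm (X *v x)\<close> attains its extrema, and these
  are singular values. Hence the set is nonempty, and its \<open>Max\<close> and \<open>Min\<close>
  bound the extrema from outside.\<close>

lemma
  fixes X :: "real^'m^'n"
  shows sigma_max_mem: "sigma_max X \<in> singular_values X"
    and sigma_min_mem: "sigma_min X \<in> singular_values X"
    and norm_le_sigma_max: "norm (X *v x) \<le> sigma_max X * norm x"
    and sigma_min_le_norm: "sigma_min X * norm x \<le> norm (X *v x)"
proof -
  have S: "compact (sphere (0::real^'m) 1)" "sphere (0::real^'m) 1 \<noteq> {}" by auto
  have c: "continuous_on (sphere 0 1) (\<lambda>x. norm (X *v x))"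
    by (intro continuous_on_norm matrix_vector_mult_linear_continuous_on)
  obtain v where "norm v = 1" "\<And>w. norm w = 1 \<Longrightarrow> norm (X *v v) \<le> norm (X *v w)"
    using continuous_attains_inf[OF S c] by auto
  note v = singular_value_of_extremum[of v 1 X, OF this(1) _ , simplified, OF this(2)]
  obtain w where "norm w = 1" "\<And>v. norm v = 1 \<Longrightarrow> norm (X *v v) \<le> norm (X *v w)"
    using continuous_attains_sup[OF S c] by auto
  note w = singular_value_of_extremum[of w "-1" X, OF this(1) _ , simplified, OF this(2)]
  have ne: "singular_values X \<noteq> {}" using v by blast
  show "sigma_max X \<in> singular_values X" "sigma_min X \<in> singular_values X"
    unfolding sigma_max_def sigma_min_def
    by (intro Max_in Min_in finite_singular_values ne)+
  have "norm (X *v w) \<le> sigma_max X" "sigma_min X \<le> norm (X *v v)"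
    unfolding sigma_max_def sigma_min_def using v w by (auto intro!: Max_ge Min_le finite_singular_values)
  then show "norm (X *v x) \<le> sigma_max X * norm x" "sigma_min X * norm x \<le> norm (X *v x)"
    using v(2)[of x] w(2)[of x] by (meson mult_right_mono norm_ge_zero order_trans)+
qed

text \<open>Testing the hypothesis on singular vectors puts every squared singular value within
  \<open>\<theta>\<close> of 1. As \<open>\<theta> < 1\<close>, \<open>sigma_min Q\<close> is
  nonzero and \<open>kappa Q\<close> is finite.\<close>

lemma kappa_le_near_orthonormal:
  fixes Q :: "real^'m^'n"
  assumes Q: "\<And>y. \<bar>(norm (Q *v y))\<^sup>2 - (norm y)\<^sup>2\<bar> \<le> \<theta> * (norm y)\<^sup>2" and \<theta>: "\<theta> < 1"
  shows "kappa Q \<le> ereal (sqrt ((1 + \<theta>) / (1 - \<theta>)))"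
proof -
  have sv: "1 - \<theta> \<le> s\<^sup>2 \<and> s\<^sup>2 \<le> 1 + \<theta> \<and> 0 \<le> s" if s: "s \<in> singular_values Q" for s
  proof -
    obtain v where v: "v \<noteq> 0" "norm (Q *v v) = s * norm v"
      by (rule singular_value_norm[OF s])
    have "(1 - \<theta>) * (norm v)\<^sup>2 \<le> s\<^sup>2 * (norm v)\<^sup>2 \<and> s\<^sup>2 * (norm v)\<^sup>2 \<le> (1 + \<theta>) * (norm v)\<^sup>2"
      using Q[of v] unfolding v(2) power_mult_distrib by (simp add: algebra_simps abs_le_iff)
    then show ?thesis using v s by (simp add: singular_values_def)
  qed
  note mx = sv[OF sigma_max_mem] and mn = sv[OF sigma_min_mem]
  have "sigma_max Q / sigma_min Q \<le> sqrt ((1 + \<theta>) / (1 - \<theta>))"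
  proof (rule real_le_rsqrt)
    show "(sigma_max Q / sigma_min Q)\<^sup>2 \<le> (1 + \<theta>) / (1 - \<theta>)"
      unfolding power_divide using mx mn \<theta> by (intro frac_le) auto
  qed
  moreover have "sigma_min Q \<noteq> 0" using mn \<theta> by auto
  ultimately show ?thesis by (simp add: kappa_def)
qed

lemma sigma_min_pos:
  fixes V :: "real^'m^'n"
  assumes "rank V = CARD('m)"
  shows "0 < sigma_min V"
proof -
  have "inj ((*v) V)" using assms by (simp add: full_rank_injective)
  obtain v where v: "v \<noteq> 0" "norm (V *v v) = sigma_min V * norm v"
    by (rule singular_value_norm[OF sigma_min_mem])
  have "V *v v \<noteq> 0"
    using injD[OF \<open>inj ((*v) V)\<close>, of v 0] v by auto
  then have "sigma_min V \<noteq> 0" using v by auto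
  moreover have "0 \<le> sigma_min V" using sigma_min_mem[of V] by (simp add: singular_values_def)
  ultimately show ?thesis by simp
qed

section \<open>Embedding probability\<close>

text \<open>By independence the joint law is the product of the marginal laws, so the probability is
  the integral of the slice probabilities. Slices over \<open>G\<close> contribute at least
  \<open>q\<close> each, the others at least 0.\<close>

lemma (in prob_space) indep_prob_slices_ge:
  fixes X :: "'a \<Rightarrow> 'b::second_countable_topology" and Y :: "'a \<Rightarrow> 'c::second_countable_topology"
  assumes X: "X \<in> borel_measurable M" and Y: "Y \<in> borel_measurable M"
    and ind: "indep_set {X -` A \<inter> space M |A. A \<in> sets borel} {Y -` B \<inter> space M |B. B \<in> sets borel}"
    and C: "C \<in> sets borel" and G: "G \<in> sets borel"
    and pG: "p \<le> prob (X -` G \<inter> space M)"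
    and q: "0 \<le> q" "\<And>x. x \<in> G \<Longrightarrow> q \<le> prob {\<omega>\<in>space M. (x, Y \<omega>) \<in> C}"
  shows "p * q \<le> prob {\<omega>\<in>space M. X \<omega> \<in> G \<and> (X \<omega>, Y \<omega>) \<in> C}"
proof -
  let ?X = "distr M borel X" and ?Y = "distr M borel Y"
  interpret PX: prob_space ?X using X by (rule prob_space_distr)
  interpret PY: prob_space ?Y using Y by (rule prob_space_distr)
  have XY: "(\<lambda>\<omega>. (X \<omega>, Y \<omega>)) \<in> M \<rightarrow>\<^sub>M borel \<Otimes>\<^sub>M borel"
    using X Y by simp
  \<comment> \<open>Independence gives agreement on measurable rectangles, which determines the
    joint law.\<close>
  have joint: "?X \<Otimes>\<^sub>M ?Y = distr M (borel \<Otimes>\<^sub>M borel) (\<lambda>\<omega>. (X \<omega>, Y \<omega>))"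
  proof (rule pair_measure_eqI)
    fix A B assume "A \<in> sets ?X" "B \<in> sets ?Y"
    then have AB: "A \<in> sets borel" "B \<in> sets borel" by auto
    have "emeasure (distr M (borel \<Otimes>\<^sub>M borel) (\<lambda>\<omega>. (X \<omega>, Y \<omega>))) (A \<times> B)
        = emeasure M ((X -` A \<inter> space M) \<inter> (Y -` B \<inter> space M))"
      using AB by (subst emeasure_distr[OF XY]) (auto intro!: arg_cong[of _ _ "emeasure M"])
    also have "\<dots> = ennreal (prob (X -` A \<inter> space M) * prob (Y -` B \<inter> space M))"
      unfolding emeasure_eq_measure using indep_setD[OF ind] AB by (metis (mono_tags, lifting) mem_Collect_eq)
    also have "\<dots> = emeasure ?X A * emeasure ?Y B"
      using AB X Y by (simp add: emeasure_distr emeasure_eq_measure ennreal_mult)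
    finally show "emeasure ?X A * emeasure ?Y B
        = emeasure (distr M (borel \<Otimes>\<^sub>M borel) (\<lambda>\<omega>. (X \<omega>, Y \<omega>))) (A \<times> B)" ..
  qed (auto intro: PX.sigma_finite_measure PY.sigma_finite_measure)
  \<comment> \<open>Second countability identifies the Borel sets of the product with the product
    sigma-algebra.\<close>
  have C': "C \<in> sets (borel \<Otimes>\<^sub>M borel)"
    using C by (subst borel_prod)
  define K where "K = (G \<times> UNIV) \<inter> C"
  have K: "K \<in> sets (borel \<Otimes>\<^sub>M borel)"
    unfolding K_def using C' G by (intro sets.Int pair_measureI) auto
  then have K': "K \<in> sets (?X \<Otimes>\<^sub>M ?Y)" by (simp cong: sets_pair_measure_cong)
  have "p * q \<le> q * prob (X -` G \<inter> space M)"
    using mult_left_mono[OF pG q(1)] by (simp add: mult.commute)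
  then have "ennreal (p * q) \<le> ennreal q * emeasure ?X G"
    using q(1) G X by (simp add: emeasure_distr emeasure_eq_measure ennreal_mult[symmetric] ennreal_leI)
  also have "\<dots> = (\<integral>\<^sup>+x. ennreal q * indicator G x \<partial>?X)"
    using G by (simp add: nn_integral_cmult_indicator)
  also have "\<dots> \<le> (\<integral>\<^sup>+x. emeasure ?Y (Pair x -` K) \<partial>?X)"
  proof (rule nn_integral_mono)
    fix x
    show "ennreal q * indicator G x \<le> emeasure ?Y (Pair x -` K)"
    proof (cases "x \<in> G")
      case True
      have "Pair x -` K \<in> sets borel"
        using K by (rule sets_Pair1)
      then have "emeasure ?Y (Pair x -` K) = emeasure M (Y -` (Pair x -` K) \<inter> space M)"
        using Y by (simp add: emeasure_distr)
      also have "Y -` (Pair x -` K) \<inter> space M = {\<omega>\<in>space M. (x, Y \<omega>) \<in> C}"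
        using True by (auto simp: K_def)
      finally show ?thesis
        using q(2)[OF True] True by (simp add: emeasure_eq_measure ennreal_leI)
    qed simp
  qed
  also have "\<dots> = emeasure (?X \<Otimes>\<^sub>M ?Y) K"
    using PY.emeasure_pair_measure_alt[OF K'] ..
  also have "\<dots> = emeasure M {\<omega>\<in>space M. X \<omega> \<in> G \<and> (X \<omega>, Y \<omega>) \<in> C}"
    unfolding joint by (subst emeasure_distr[OF XY K]) (auto simp: K_def intro!: arg_cong[of _ _ "emeasure M"])
  finally show ?thesis
    by (simp add: emeasure_eq_measure)
qed

section \<open>Measurability and probability of the embedding events\<close>

lemma continuous_on_matrix_vector_mult [continuous_intros]:
  fixes f :: "'a::topological_space \<Rightarrow> real^'m^'n"
  assumes "continuous_on S f" "continuous_on S g"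
  shows "continuous_on S (\<lambda>x. f x *v g x)"
  unfolding matrix_vector_mult_def by (intro continuous_intros assms)

lemma subspace_embedding_norm:
  assumes "subspace_embedding \<epsilon> \<V> S" "x \<in> \<V>"
  shows "(1 - \<epsilon>) * (norm x)\<^sup>2 \<le> (norm (S *v x))\<^sup>2" "(norm (S *v x))\<^sup>2 \<le> (1 + \<epsilon>) * (norm x)\<^sup>2"
proof -
  have "\<bar>x \<bullet> x - (S *v x) \<bullet> (S *v x)\<bar> \<le> \<epsilon> * norm x * norm x"
    using assms unfolding subspace_embedding_def by blast
  then have "\<bar>(norm x)\<^sup>2 - (norm (S *v x))\<^sup>2\<bar> \<le> \<epsilon> * (norm x)\<^sup>2"
    by (simp add: power2_norm_eq_inner mult.assoc norm_eq_sqrt_inner)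
  then show "(1 - \<epsilon>) * (norm x)\<^sup>2 \<le> (norm (S *v x))\<^sup>2" "(norm (S *v x))\<^sup>2 \<le> (1 + \<epsilon>) * (norm x)\<^sup>2"
    by (simp_all add: abs_le_iff algebra_simps)
qed

text \<open>An intersection of closed conditions, one for each pair of vectors. Closedness makes the
  event measurable although uncountably many pairs are involved.\<close>

lemma closed_subspace_embedding: "closed {S. subspace_embedding \<epsilon> \<V> S}"
  unfolding subspace_embedding_def Ball_def
  by (intro closed_Collect_all closed_Collect_imp closed_Collect_le open_Collect_const continuous_intros)

text \<open>The embedded subspace varies with \<open>X\<close>. Parametrizing it by arguments of
  \<open>V\<close> turns the condition into inequalities continuous in the pair
  \<open>(X, Y)\<close>.\<close>

lemma closed_subspace_embedding_image:
  fixes V :: "real^'m^'n"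
  shows "closed {(X :: real^'n^'p, Y :: real^'p^'q). subspace_embedding \<epsilon> (range (\<lambda>x. X *v (V *v x))) Y}"
proof -
  have eq: "{(X :: real^'n^'p, Y :: real^'p^'q). subspace_embedding \<epsilon> (range (\<lambda>x. X *v (V *v x))) Y}
    = {p. \<forall>x y. \<bar>(fst p *v (V *v x)) \<bullet> (fst p *v (V *v y))
         - (snd p *v (fst p *v (V *v x))) \<bullet> (snd p *v (fst p *v (V *v y)))\<bar>
         \<le> \<epsilon> * norm (fst p *v (V *v x)) * norm (fst p *v (V *v y))}"
    by (auto simp: subspace_embedding_def)
  show ?thesis
    unfolding eq by (intro closed_Collect_all closed_Collect_le continuous_intros)
qed

text \<open>The subspace that \<open>S2\<close> must embed is random, whereas obliviousness concerns
  fixed subspaces. Independence permits freezing \<open>S1\<close> at a good value \<open>X\<close>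
  and applying obliviousness of \<open>S2\<close> to the range of \<open>X ** V\<close>.\<close>

lemma prob_both_embeddings:
  fixes S1 :: "'a \<Rightarrow> real^'n^'p1" and S2 :: "'a \<Rightarrow> real^'p1^'p2" and V :: "real^'m^'n"
  assumes "prob_space M"
    and S1: "oblivious_embedding M \<epsilon>1 d1 CARD('m) S1" and S2: "oblivious_embedding M \<epsilon>2 d2 CARD('m) S2"
    and ind: "independent_matrices M S1 S2"
    and \<epsilon>1: "\<epsilon>1 < 1" and d: "d2 \<le> 1" and V: "rank V = CARD('m)"
  shows "{\<omega>\<in>space M. subspace_embedding \<epsilon>1 (range ((*v) V)) (S1 \<omega>) \<and>
            subspace_embedding \<epsilon>2 (range (\<lambda>x. S1 \<omega> *v (V *v x))) (S2 \<omega>)} \<in> sets M" (is "?A \<in> _")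
    and "(1 - d1) * (1 - d2) \<le> measure M {\<omega>\<in>space M. subspace_embedding \<epsilon>1 (range ((*v) V)) (S1 \<omega>) \<and>
            subspace_embedding \<epsilon>2 (range (\<lambda>x. S1 \<omega> *v (V *v x))) (S2 \<omega>)}"
proof -
  interpret prob_space M by fact
  have meas: "S1 \<in> borel_measurable M" "S2 \<in> borel_measurable M"
    using S1 S2 by (auto simp: oblivious_embedding_def)
  define G :: "(real^'n^'p1) set" where "G = {X. subspace_embedding \<epsilon>1 (range ((*v) V)) X}"
  define C :: "((real^'n^'p1) \<times> (real^'p1^'p2)) set"
    where "C = {(X, Y). subspace_embedding \<epsilon>2 (range (\<lambda>x. X *v (V *v x))) Y}"
  have G: "G \<in> sets borel" unfolding G_def by (intro borel_closed closed_subspace_embedding)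
  have C: "C \<in> sets borel" unfolding C_def by (intro borel_closed closed_subspace_embedding_image)
  have A: "?A = {\<omega>\<in>space M. S1 \<omega> \<in> G \<and> (S1 \<omega>, S2 \<omega>) \<in> C}"
    by (auto simp: G_def C_def)
  have pairm: "(\<lambda>\<omega>. (S1 \<omega>, S2 \<omega>)) \<in> borel_measurable M"
    using measurable_Pair[OF meas] by (simp add: borel_prod)
  show "?A \<in> sets M"
    unfolding A using measurable_sets[OF meas(1) G] measurable_sets[OF pairm C]
    by (auto simp: vimage_def Int_def conj_commute dest: sets.Int)
  have sub: "subspace (range ((*v) B))" for B :: "real^'m^'k"
    by (intro linear_subspace_image subspace_UNIV) auto
  have "dim (range ((*v) V)) = CARD('m)"
    using V by (simp add: rank_dim_range)
  then have "1 - d1 \<le> prob {\<omega>\<in>space M. subspace_embedding \<epsilon>1 (range ((*v) V)) (S1 \<omega>)}"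
    using S1 sub unfolding oblivious_embedding_def by blast
  then have 1: "1 - d1 \<le> prob (S1 -` G \<inter> space M)"
    by (simp add: G_def vimage_def Int_def conj_commute)
  have 2: "1 - d2 \<le> prob {\<omega>\<in>space M. (X, S2 \<omega>) \<in> C}" if "X \<in> G" for X
  proof -
    have Vinj: "inj ((*v) V)" using V by (simp add: full_rank_injective)
    \<comment> \<open>As \<open>\<epsilon>1 < 1\<close>, an embedding annihilates no nonzero vector
      of the range of \<open>V\<close>. The image therefore has dimension exactly
      \<open>CARD('m)\<close>, as obliviousness demands.\<close>
    have "x = 0" if "(X ** V) *v x = 0" for x
    proof -
      have "(1 - \<epsilon>1) * (norm (V *v x))\<^sup>2 \<le> (norm (X *v (V *v x)))\<^sup>2"
        using \<open>X \<in> G\<close> unfolding G_def by (intro subspace_embedding_norm) auto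
      then have "V *v x = 0" using \<epsilon>1 that by (simp add: matrix_vector_mul_assoc mult_le_0_iff)
      then show ?thesis using injD[OF Vinj, of x 0] by simp
    qed
    then have "inj ((*v) (X ** V))" by (subst linear_injective_0) auto
    then have "dim (range ((*v) (X ** V))) = CARD('m)"
      by (simp flip: full_rank_injective add: rank_dim_range)
    then have "1 - d2 \<le> prob {\<omega>\<in>space M. subspace_embedding \<epsilon>2 (range ((*v) (X ** V))) (S2 \<omega>)}"
      using S2 sub unfolding oblivious_embedding_def by blast
    then show ?thesis by (simp add: C_def matrix_vector_mul_assoc)
  qed
  show "(1 - d1) * (1 - d2) \<le> prob ?A"
    unfolding A using d ind 1 2 meas
    by (intro indep_prob_slices_ge C G) (auto simp: independent_matrices_def)
qed

section \<open>The condition number of the computed factor\<close>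

text \<open>The good event \<open>A\<close> is fixed before the rounding outcomes \<open>Q\<close>
  and \<open>R\<close> are quantified, so these may depend on the sample in any way. The probability
  is \<open>(1 - d1) * (1 - d2) = 1 - d\<close>.\<close>

theorem theorem5p4:
  fixes M :: "'a measure"
    and S1 :: "'a \<Rightarrow> real^'n^'p1" and S2 :: "'a \<Rightarrow> real^'p1^'p2"
    and V :: "real^('m::{finite,linorder})^'n"
    and \<epsilon>1 \<epsilon>2 d1 d2 d \<epsilon>L \<epsilon>H u n m p1 p2 c :: real
    and \<delta> :: "'a \<Rightarrow> ereal"
  assumes "prob_space M"
    and "n = real CARD('n)" and "m = real CARD('m)"
    and "p1 = real CARD('p1)" and "p2 = real CARD('p2)"
    and "0 \<le> \<epsilon>1" "\<epsilon>1 < 1" "0 \<le> \<epsilon>2" "\<epsilon>2 < 1"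
    and "0 \<le> d1" "d1 \<le> 1" "0 \<le> d2" "d2 \<le> 1"
    and "oblivious_embedding M \<epsilon>1 d1 CARD('m) S1"
    and "oblivious_embedding M \<epsilon>2 d2 CARD('m) S2"
    and "independent_matrices M S1 S2"
    and "d = d1 + d2 - d1 * d2"
    and "\<epsilon>L = \<epsilon>1 + \<epsilon>2 - \<epsilon>1 * \<epsilon>2"
    and "\<epsilon>H = \<epsilon>1 + \<epsilon>2 + \<epsilon>1 * \<epsilon>2"
    and "0 \<le> \<epsilon>L" "\<epsilon>L < 616 / 625 - 9 / 625 * \<epsilon>H"
    and "rank V = CARD('m)"
    and "1 < m" "m \<le> p2" "p2 \<le> p1" "p1 \<le> n"
    and "0 < u"
    and "n * m * u \<le> 1 / 12"
    and "p1 * sqrt p2 * u \<le> 1 / 12"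
    and "\<delta> = (\<lambda>\<omega>. ereal
          (383 * (sqrt (1 + \<epsilon>H) * p2 * m powr (3 / 2)
                  + sqrt m * onorm (\<lambda>x. S2 \<omega> *v x)
                      * (p1 * sqrt p2 * sqrt (1 + \<epsilon>1) + n * norm (S1 \<omega>)))
             / sqrt (1 - \<epsilon>L) * u) * kappa V)"
    and "c = 5445 / (25 * sqrt ((1 - \<epsilon>L) / (1 + \<epsilon>H)) - 3)\<^sup>2 * (n * m + m * (m + 1)) * u"
  shows "\<exists>A\<in>sets M. measure M A \<ge> 1 - d \<and>
           (\<forall>\<omega>\<in>A. \<delta> \<omega> \<le> 1 \<longrightarrow>
              (\<forall>Q R. fl_rand_cholQR u V (S1 \<omega>) (S2 \<omega>) Q R \<longrightarrow>
                 (c < 1 \<longrightarrow> kappa Q < ereal (sqrt ((1 + c) / (1 - c)))) \<and>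
                 (c < 1 / 2 \<longrightarrow> kappa Q < ereal (1 + 2 * c))))"
proof -
  note eqs = assms(2-5)
  have dims: "2 \<le> m" "m \<le> p2" "p2 \<le> p1" "p1 \<le> n"
    using assms(23-26) eqs(2) by auto
  have u: "0 < u" "n * m * u \<le> 1 / 12" "p1 * sqrt p2 * u \<le> 1 / 12" by fact+
  have \<epsilon>: "0 \<le> \<epsilon>1" "\<epsilon>1 < 1" "0 \<le> \<epsilon>2" "\<epsilon>2 < 1" by fact+
  define a b b1 where "a = sqrt (1 - \<epsilon>L)" and "b = sqrt (1 + \<epsilon>H)" and "b1 = sqrt (1 + \<epsilon>1)"
  \<comment> \<open>The distortions of the two sketches multiply.\<close>
  have L: "1 - \<epsilon>L = (1 - \<epsilon>1) * (1 - \<epsilon>2)" and H: "1 + \<epsilon>H = (1 + \<epsilon>1) * (1 + \<epsilon>2)"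
    using assms(18,19) by (simp_all add: algebra_simps)
  have H0: "0 \<le> \<epsilon>H" using \<epsilon> assms(19) by simp
  have L0: "0 < 1 - \<epsilon>L" unfolding L using \<epsilon> by simp
  have a: "0 < a" "a\<^sup>2 = 1 - \<epsilon>L" using L0 by (auto simp: a_def)
  have b: "0 < b" "b\<^sup>2 = 1 + \<epsilon>H" using H0 by (auto simp: b_def)
  have b1: "0 \<le> b1" "b1\<^sup>2 = 1 + \<epsilon>1" using \<epsilon> by (auto simp: b1_def)
  have ab: "a \<le> b" unfolding a_def b_def using assms(20) H0 by simp
  have r: "sqrt ((1 - \<epsilon>L) / (1 + \<epsilon>H)) = a / b"
    by (simp add: a_def b_def real_sqrt_divide)
  \<comment> \<open>Squared, this is the upper bound assumed for \<open>\<epsilon>L\<close>. It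
    makes \<open>25 * (a / b) - 3\<close> and the lower bound \<open>s\<close> for \<open>Q0\<close>
    positive.\<close>
  have "3 / 25 * b < a"
  proof (rule power2_less_imp_less)
    show "(3 / 25 * b)\<^sup>2 < a\<^sup>2"
      using assms(21) unfolding power_mult_distrib a(2) b(2) by (simp add: power2_eq_square)
  qed (use a in simp)
  then have r3: "3 / 25 < a / b" using b by (simp add: field_simps)
  define s t where "s = 10 / 11 * (1 / b - 3 / 25 / a)" and "t = 6 / 5 / a"
  have "s * a = 10 / 11 * (a / b - 3 / 25)" using a by (simp add: s_def algebra_simps)
  then have ts: "t / s = 33 / (25 * (a / b) - 3)"
  proof -
    have "6 / 5 / (10 / 11 * (x - 3 / 25)) = 33 / (25 * x - 3)" if "3 / 25 < x" for x :: real
      using that by (simp add: field_simps)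
    moreover have "t / s = (t * a) / (s * a)" using a by simp
    moreover have "t * a = 6 / 5" using a by (simp add: t_def)
    ultimately show ?thesis using \<open>s * a = _\<close> r3 by metis
  qed
  have "0 < s * a" unfolding \<open>s * a = _\<close> using r3 by simp
  then have s: "0 < s" using a by (simp add: zero_less_mult_iff)
  define g where "g = (t / s)\<^sup>2 * (n * m + m * (m + 1)) * u"
  have cg: "c = 5 * g"
    unfolding assms(31) r g_def ts by (simp add: power_divide)
  have "0 < t" using a by (simp add: t_def)
  then have c0: "0 < c"
    unfolding cg g_def using s u dims by (intro mult_pos_pos add_pos_pos zero_less_power divide_pos_pos) auto
  define A where "A = {\<omega>\<in>space M. subspace_embedding \<epsilon>1 (range ((*v) V)) (S1 \<omega>) \<and>
            subspace_embedding \<epsilon>2 (range (\<lambda>x. S1 \<omega> *v (V *v x))) (S2 \<omega>)}"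
  have A: "A \<in> sets M" "1 - d \<le> measure M A"
    using prob_both_embeddings[OF assms(1,14,15,16,7,13,22)] assms(17)
    by (simp_all add: A_def algebra_simps)
  \<comment> \<open>Since \<open>c = 5 * g\<close>, the bound \<open>9 / 2 * g\<close> reads
    \<open>9 / 10 * c\<close>, and \<open>c < 1\<close> is the condition \<open>g < 1 / 5\<close> of
    Cholesky QR. Replacing \<open>9 / 10 * c\<close> by \<open>c\<close> makes the final inequality
    strict.\<close>
  have kQ: "kappa Q \<le> ereal (sqrt ((1 + 9 / 10 * c) / (1 - 9 / 10 * c)))"
    if \<omega>: "\<omega> \<in> A" and \<delta>: "\<delta> \<omega> \<le> 1" and alg: "fl_rand_cholQR u V (S1 \<omega>) (S2 \<omega>) Q R" and c1: "c < 1"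
    for \<omega> Q R
  proof -
    obtain Q0 R0 R1 where rqr: "fl_randQR u V (S1 \<omega>) (S2 \<omega>) Q0 R0" and cqr: "fl_cholQR u Q0 Q R1"
      using alg unfolding fl_rand_cholQR_def by auto
    have e1: "(1 - \<epsilon>1) * (norm (V *v x))\<^sup>2 \<le> (norm (S1 \<omega> *v (V *v x)))\<^sup>2"
      "(norm (S1 \<omega> *v (V *v x)))\<^sup>2 \<le> (1 + \<epsilon>1) * (norm (V *v x))\<^sup>2" for x
      using \<omega> by (auto simp: A_def intro: subspace_embedding_norm)
    have e2: "(1 - \<epsilon>2) * (norm (S1 \<omega> *v (V *v x)))\<^sup>2 \<le> (norm (S2 \<omega> *v (S1 \<omega> *v (V *v x))))\<^sup>2"
      "(norm (S2 \<omega> *v (S1 \<omega> *v (V *v x))))\<^sup>2 \<le> (1 + \<epsilon>2) * (norm (S1 \<omega> *v (V *v x)))\<^sup>2" for x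
      using \<omega> by (auto simp: A_def intro: subspace_embedding_norm)
    have Sb1: "norm (S1 \<omega> *v (V *v x)) \<le> b1 * norm (V *v x)" for x
      by (rule power2_le_imp_le) (use e1[of x] b1 in \<open>auto simp: power_mult_distrib\<close>)
    have Slo: "a * norm (V *v x) \<le> norm (S2 \<omega> *v (S1 \<omega> *v (V *v x)))" for x
    proof (rule power2_le_imp_le)
      have "(1 - \<epsilon>2) * ((1 - \<epsilon>1) * (norm (V *v x))\<^sup>2) \<le> (1 - \<epsilon>2) * (norm (S1 \<omega> *v (V *v x)))\<^sup>2"
        using \<epsilon> e1 by (intro mult_left_mono) auto
      then show "(a * norm (V *v x))\<^sup>2 \<le> (norm (S2 \<omega> *v (S1 \<omega> *v (V *v x))))\<^sup>2"
        using e2(1)[of x] unfolding power_mult_distrib a(2) L by (simp only: mult_ac)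
    qed simp
    have Sup: "norm (S2 \<omega> *v (S1 \<omega> *v (V *v x))) \<le> b * norm (V *v x)" for x
    proof (rule power2_le_imp_le)
      have "(1 + \<epsilon>2) * (norm (S1 \<omega> *v (V *v x)))\<^sup>2 \<le> (1 + \<epsilon>2) * ((1 + \<epsilon>1) * (norm (V *v x))\<^sup>2)"
        using \<epsilon> e1 by (intro mult_left_mono) auto
      then show "(norm (S2 \<omega> *v (S1 \<omega> *v (V *v x))))\<^sup>2 \<le> (b * norm (V *v x))\<^sup>2"
        using e2(2)[of x] unfolding power_mult_distrib b(2) H by (simp only: mult_ac)
    qed (use b in simp)
    have lo: "0 < sigma_min V" using assms(22) by (rule sigma_min_pos)
    have "m powr (3 / 2) = m * sqrt m"
      using dims powr_add[of m 1 "1 / 2"] by (simp add: powr_half_sqrt)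
    \<comment> \<open>Full rank makes \<open>kappa V\<close> finite, so the extended real bound
      becomes a real one.\<close>
    then have \<delta>1: "383 * (b * p2 * (m * sqrt m) + sqrt m * onorm (\<lambda>x. S2 \<omega> *v x) *
        (p1 * sqrt p2 * b1 + n * norm (S1 \<omega>))) / a * u * (sigma_max V / sigma_min V) \<le> 1"
      using \<delta> lo unfolding assms(30) kappa_def a_def b_def b1_def by (simp add: one_ereal_def)
    have \<delta>2: "383 * (b * p2 * (m * sqrt m) + sqrt m * onorm (\<lambda>x. S2 \<omega> *v x) *
        (p1 * sqrt p2 * b1 + n * norm (S1 \<omega>))) * u * sigma_max V \<le> a * sigma_min V"
    proof -
      have "X * u * \<sigma> \<le> a * \<tau>" if "X / a * u * (\<sigma> / \<tau>) \<le> 1" "0 < \<tau>" for X \<sigma> \<tau>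
        using that a by (simp add: field_simps)
      then show ?thesis using \<delta>1 lo by blast
    qed
    note Q0 = fl_randQR_well_conditioned[OF rqr eqs dims u a(1) ab b1(1) lo sigma_min_le_norm
        norm_le_sigma_max Sb1 Slo Sup \<delta>2, folded s_def t_def]
    have g: "g < 1 / 5" using cg c1 by simp
    have mn: "m \<le> n" using dims by simp
    have "\<bar>(norm (Q *v y))\<^sup>2 - (norm y)\<^sup>2\<bar> \<le> 9 / 2 * g * (norm y)\<^sup>2" for y
      by (rule fl_cholQR_near_orthonormal[OF cqr eqs(1,2) dims(1) mn u(1,2) s Q0 g_def g])
    then have "\<And>y. \<bar>(norm (Q *v y))\<^sup>2 - (norm y)\<^sup>2\<bar> \<le> 9 / 10 * c * (norm y)\<^sup>2"
      by (simp add: cg)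
    then show ?thesis using c1 by (intro kappa_le_near_orthonormal) auto
  qed
  have less: "sqrt ((1 + 9 / 10 * c) / (1 - 9 / 10 * c)) < sqrt ((1 + c) / (1 - c))" if "c < 1"
    using that c0 by (intro real_sqrt_less_mono frac_less) auto
  \<comment> \<open>Squaring and clearing the denominator leaves
    \<open>4 * c ^ 3 \<le> 2 * c\<close>.\<close>
  have two: "sqrt ((1 + c) / (1 - c)) \<le> 1 + 2 * c" if "c < 1 / 2"
  proof (rule real_le_lsqrt)
    have "c * c \<le> 1 / 2 * (1 / 2)" using that c0 by (intro mult_mono) auto
    then have "2 * c * (2 * (c * c)) \<le> 2 * c * 1" using c0 by (intro mult_left_mono) auto
    then have "1 + c \<le> (1 + 2 * c)\<^sup>2 * (1 - c)" by (simp add: power2_eq_square algebra_simps)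
    then show "(1 + c) / (1 - c) \<le> (1 + 2 * c)\<^sup>2" using that by (simp add: divide_le_eq)
  qed (use c0 in simp)
  show ?thesis
  proof (intro bexI[of _ A] conjI ballI impI allI)
    fix \<omega> Q R
    assume \<omega>: "\<omega> \<in> A" "\<delta> \<omega> \<le> 1" "fl_rand_cholQR u V (S1 \<omega>) (S2 \<omega>) Q R"
    show *: "kappa Q < ereal (sqrt ((1 + c) / (1 - c)))" if "c < 1"
      using le_less_trans[OF kQ[OF \<omega> that]] less[OF that] by simp
    show "kappa Q < ereal (1 + 2 * c)" if "c < 1 / 2"
      using less_le_trans[OF *] two[OF that] that by simp
  qed (use A in auto)
qed

end
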